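(* The algebra $\mathcal{D}'$ is isomorphic, as a $\Bbbk$-algebra, to the localized Weyl algebra $A_2'(S)$, with center $S:=\Bbbk[z^{\pm1},z']$, where $z$ and $z'$ are algebraically independent over $\Bbbk$.
   Context: $\Bbbk$ is an algebraically closed field of characteristic $0$. The algebra $\mathcal{D}$ (the double of the Jordan plane) is the associative unital $\Bbbk$-algebra with generators $u, v, \zeta, g^{\pm1}, x, y$ and relations $g^{\pm1}g^{\mp1}=1$, $\zeta g=g\zeta$, $gx=xg$, $gy=yg+xg$, $\zeta y=y\zeta+y$, $\zeta x=x\zeta+x$, $ug=gu$, $vg=gv+gu$, $v\zeta=\zeta v+v$, $u\zeta=\zeta u+u$, $yx=xy-\frac12x^2$, $vu=uv-\frac12u^2$, $ux=xu$, $vx=xv+(1-g)+xu$, $uy=yu+(1-g)$, $vy=yv-g\zeta+yu$. It is a noetherian domain with PBW basis $\{x^ny^rg^m\zeta^ku^iv^j: i,j,k,n,r\in\mathbb{N}_0,\ m\in\mathbb{Z}\}$. Set $q:=ux+2(1+g)$ and $z:=q^2g^{-1}$ in $\mathcal{D}$. The element $x$ is ad-locally nilpotent, $q$ is normal in $\mathcal{D}$, and $x$ and $q$ commute; $\mathcal{D}'$ denotes the (Ore) localization of $\mathcal{D}$ with respect to the multiplicative set generated by $x$ and $q$. In $\mathcal{D}'$ the element $z$ is invertible, $z^{-1}=gq^{-2}$, and one sets $$z':=q^{-1}\left[xv+uy+\left(-\tfrac12ux+g-1\right)\zeta-2(1+g)\right].$$ For a commutative ring $R$, the algebra $A_2'(R)$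 is the localization of the second Weyl algebra $A_2(R)$ (the $R$-algebra generated by $q_1,q_2,p_1,p_2$ with $p_iq_j-q_jp_i=\delta_{ij}$, $q_1q_2=q_2q_1$, $p_1p_2=p_2p_1$) at the multiplicative set generated by $q_1$ and $q_2$, i.e. $A_2'(R)=R[q_1^{\pm1},q_2^{\pm1}][p_1;\partial_{q_1}][p_2;\partial_{q_2}]$. *)

theory Defs
  imports
    "HOL-Library.Poly_Mapping"
    "HOL-Computational_Algebra.Polynomial"
begin

section \<open>Free associative algebras\<close>

datatype 'g free_monoid = Free_Word (letters: "'g list")

instantiation free_monoid :: (type) monoid_add
begin

definition "0 = Free_Word []"
definition "a + b = Free_Word (letters a @ letters b)"

instance
  by standard (simp_all add: zero_free_monoid_def plus_free_monoid_def)

end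

lemma letters_zero [simp]: "letters 0 = []"
  by (simp add: zero_free_monoid_def)

lemma letters_plus [simp]: "letters (a + b) = letters a @ letters b"
  by (simp add: plus_free_monoid_def)

text \<open>The free algebra on the generators \<open>'g\<close> over the commutative ring \<open>'r\<close> is the monoid
  algebra of the free monoid; the product of \<^typ>\<open>'a \<Rightarrow>\<^sub>0 'b\<close> is the convolution product.\<close>

type_synonym ('g, 'r) free_algebra = "'g free_monoid \<Rightarrow>\<^sub>0 'r"

definition free_gen :: "'g \<Rightarrow> ('g, 'r::comm_ring_1) free_algebra"
  where "free_gen g = Poly_Mapping.single (Free_Word [g]) 1"

definition free_scalar :: "'r::comm_ring_1 \<Rightarrow> ('g, 'r) free_algebra"
  where "free_scalar c = Poly_Mapping.single 0 c"

inductive_set two_sided_ideal :: "'a::ring_1 set \<Rightarrow> 'a set" for R :: "'a set"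
  where
    zero: "0 \<in> two_sided_ideal R"
  | gen: "r \<in> R \<Longrightarrow> a * r * b \<in> two_sided_ideal R"
  | add: "s \<in> two_sided_ideal R \<Longrightarrow> t \<in> two_sided_ideal R \<Longrightarrow> s + t \<in> two_sided_ideal R"

lemma two_sided_ideal_mult_left:
  "s \<in> two_sided_ideal R \<Longrightarrow> c * s \<in> two_sided_ideal R"
proof (induction rule: two_sided_ideal.induct)
  case (gen r a b)
  then have "(c * a) * r * b \<in> two_sided_ideal R" by (rule two_sided_ideal.gen)
  then show ?case by (simp add: mult.assoc)
qed (auto simp: distrib_left intro: two_sided_ideal.intros)

lemma two_sided_ideal_mult_right:
  "s \<in> two_sided_ideal R \<Longrightarrow> s * c \<in> two_sided_ideal R"
proof (induction rule: two_sided_ideal.induct)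
  case (gen r a b)
  then have "a * r * (b * c) \<in> two_sided_ideal R" by (rule two_sided_ideal.gen)
  then show ?case by (simp add: mult.assoc)
qed (auto simp: distrib_right intro: two_sided_ideal.intros)

lemma two_sided_ideal_uminus:
  "s \<in> two_sided_ideal R \<Longrightarrow> - s \<in> two_sided_ideal R"
  using two_sided_ideal_mult_left[of s R "-1"] by simp

lemma two_sided_ideal_base: "r \<in> R \<Longrightarrow> r \<in> two_sided_ideal R"
  using two_sided_ideal.gen[of r R 1 1] by simp

definition ideal_cong :: "'a::ring_1 set \<Rightarrow> 'a \<Rightarrow> 'a \<Rightarrow> bool"
  where "ideal_cong R a b \<longleftrightarrow> a - b \<in> two_sided_ideal R"

lemma ideal_cong_refl: "ideal_cong R a a"
  by (simp add: ideal_cong_def two_sided_ideal.zero)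

lemma ideal_cong_sym: "ideal_cong R a b \<Longrightarrow> ideal_cong R b a"
  unfolding ideal_cong_def using two_sided_ideal_uminus[of "a - b" R] by simp

lemma ideal_cong_trans: "ideal_cong R a b \<Longrightarrow> ideal_cong R b c \<Longrightarrow> ideal_cong R a c"
  unfolding ideal_cong_def using two_sided_ideal.add[of "a - b" R "b - c"] by simp

lemma equivp_ideal_cong: "equivp (ideal_cong R)"
  by (intro equivpI reflpI sympI transpI)
     (blast intro: ideal_cong_refl ideal_cong_sym ideal_cong_trans)+

lemma ideal_cong_add:
  "ideal_cong R a b \<Longrightarrow> ideal_cong R c d \<Longrightarrow> ideal_cong R (a + c) (b + d)"
  unfolding ideal_cong_def using two_sided_ideal.add[of "a - b" R "c - d"]
  by (simp add: algebra_simps)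

lemma ideal_cong_uminus: "ideal_cong R a b \<Longrightarrow> ideal_cong R (- a) (- b)"
  unfolding ideal_cong_def using two_sided_ideal_uminus[of "a - b" R] by simp

lemma ideal_cong_diff:
  "ideal_cong R a b \<Longrightarrow> ideal_cong R c d \<Longrightarrow> ideal_cong R (a - c) (b - d)"
  using ideal_cong_add[of R a b "- c" "- d"] ideal_cong_uminus[of R c d] by simp

lemma ideal_cong_mult:
  assumes "ideal_cong R a b" "ideal_cong R c d"
  shows "ideal_cong R (a * c) (b * d)"
proof -
  have "(a - b) * c + b * (c - d) \<in> two_sided_ideal R"
    using assms unfolding ideal_cong_def
    by (intro two_sided_ideal.add two_sided_ideal_mult_left two_sided_ideal_mult_right)
  then show ?thesis by (simp add: ideal_cong_def algebra_simps)
qed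

text \<open>An action of the free algebra by linear operators on functions \<open>'i \<Rightarrow> 'r\<close>; it serves to
  show that the algebras presented below are nonzero.\<close>

definition free_act ::
    "('g \<Rightarrow> ('i \<Rightarrow> 'r) \<Rightarrow> ('i \<Rightarrow> 'r)) \<Rightarrow> ('g, 'r::comm_ring_1) free_algebra \<Rightarrow> ('i \<Rightarrow> 'r) \<Rightarrow> 'i \<Rightarrow> 'r"
  where "free_act op F f i =
    (\<Sum>w\<in>Poly_Mapping.keys F. Poly_Mapping.lookup F w * foldr op (letters w) f i)"

definition linear_op :: "(('i \<Rightarrow> 'r::comm_ring_1) \<Rightarrow> ('i \<Rightarrow> 'r)) \<Rightarrow> bool"
  where "linear_op T \<longleftrightarrow> (\<forall>f g. T (\<lambda>i. f i + g i) = (\<lambda>i. T f i + T g i))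
    \<and> (\<forall>c f. T (\<lambda>i. c * f i) = (\<lambda>i. c * T f i))"

lemma free_act_superset:
  assumes "finite A" "Poly_Mapping.keys F \<subseteq> A"
  shows "free_act op F f i = (\<Sum>w\<in>A. Poly_Mapping.lookup F w * foldr op (letters w) f i)"
  unfolding free_act_def using assms by (intro sum.mono_neutral_left) (auto simp: in_keys_iff)

lemma free_act_add: "free_act op (F + G) f i = free_act op F f i + free_act op G f i"
proof -
  let ?A = "Poly_Mapping.keys F \<union> Poly_Mapping.keys G"
  have "Poly_Mapping.keys (F + G) \<subseteq> ?A" by (rule Poly_Mapping.keys_add)
  then show ?thesis
    by (simp add: free_act_superset[of ?A] lookup_add distrib_right sum.distrib)
qed

lemma free_act_zero: "free_act op 0 f i = 0"
  by (simp add: free_act_def)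

lemma free_act_sum: "free_act op (sum F A) f i = (\<Sum>a\<in>A. free_act op (F a) f i)"
  by (induction A rule: infinite_finite_induct) (simp_all add: free_act_zero free_act_add)

lemma free_act_uminus: "free_act op (- F) f i = - free_act op F f i"
  using free_act_add[of op F "- F" f i] by (simp add: free_act_zero eq_neg_iff_add_eq_0 add.commute)

lemma free_act_diff: "free_act op (F - G) f i = free_act op F f i - free_act op G f i"
  using free_act_add[of op F "- G" f i] by (simp add: free_act_uminus)

lemma free_act_single:
  "free_act op (Poly_Mapping.single w c) f i = c * foldr op (letters w) f i"
  by (simp add: free_act_superset[of "{w}"])

lemma poly_mapping_expand:
  "F = (\<Sum>w\<in>Poly_Mapping.keys F. Poly_Mapping.single w (Poly_Mapping.lookup F w))"
  by (rule poly_mapping_eqI) (simp add: lookup_sum lookup_single when_def in_keys_iff)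

lemma linear_op_zero:
  assumes "linear_op T"
  shows "T (\<lambda>i. 0) = (\<lambda>i. 0)"
proof -
  have "T (\<lambda>i. 0 * undefined i) = (\<lambda>i. 0 * T undefined i)"
    using assms unfolding linear_op_def by blast
  then show ?thesis by simp
qed

lemma linear_op_foldr:
  assumes "\<And>g. linear_op (op g)"
  shows "linear_op (foldr op ws)"
  using assms by (induction ws) (simp_all add: linear_op_def)

lemma linear_op_sum:
  assumes "linear_op T"
  shows "T (\<lambda>i. \<Sum>a\<in>A. c a * h a i) = (\<lambda>i. \<Sum>a\<in>A. c a * T (h a) i)"
  using assms by (induction A rule: infinite_finite_induct)
    (simp_all add: linear_op_zero linear_op_def)

lemma free_act_mult:
  assumes "\<And>g. linear_op (op g)"
  shows "free_act op (F * G) f = free_act op F (free_act op G f)"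
proof
  fix i
  let ?S = "Poly_Mapping.single"
  let ?l = "Poly_Mapping.lookup"
  have G: "free_act op G f =
      (\<lambda>j. \<Sum>v\<in>Poly_Mapping.keys G. ?l G v * foldr op (letters v) f j)"
    by (rule ext) (simp add: free_act_def)
  have "F * G = (\<Sum>u\<in>Poly_Mapping.keys F. \<Sum>v\<in>Poly_Mapping.keys G.
      ?S u (?l F u) * ?S v (?l G v))"
    by (subst poly_mapping_expand[of F], subst poly_mapping_expand[of G])
       (simp only: sum_product)
  then have "free_act op (F * G) f i = (\<Sum>u\<in>Poly_Mapping.keys F. \<Sum>v\<in>Poly_Mapping.keys G.
      ?l F u * ?l G v * foldr op (letters u) (foldr op (letters v) f) i)"
    by (simp add: free_act_sum mult_single free_act_single)
  also have "\<dots> = free_act op F (free_act op G f) i"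
    unfolding G free_act_def[of op F]
    by (simp add: linear_op_sum[OF linear_op_foldr[OF assms]] sum_distrib_left mult.assoc)
  finally show "free_act op (F * G) f i = free_act op F (free_act op G f) i" .
qed

lemma free_act_gen: "free_act op (free_gen g) f = op g f"
  by (rule ext) (simp add: free_gen_def free_act_single)

lemma free_act_scalar: "free_act op (free_scalar c) f = (\<lambda>i. c * f i)"
  by (rule ext) (simp add: free_scalar_def free_act_single)

lemma free_act_one: "free_act op 1 f = f"
  using free_act_scalar[of op 1 f] by (simp add: free_scalar_def single_one)

lemma free_act_ideal:
  assumes lin: "\<And>g. linear_op (op g)"
    and rel: "\<And>r f. r \<in> R \<Longrightarrow> free_act op r f = (\<lambda>i. 0)"
    and "s \<in> two_sided_ideal R"
  shows "free_act op s f = (\<lambda>i. 0)"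
  using assms(3)
proof (induction arbitrary: f rule: two_sided_ideal.induct)
  case zero
  then show ?case by (simp add: free_act_zero fun_eq_iff)
next
  case (gen r a b)
  have "free_act op a (\<lambda>i. 0) = (\<lambda>i. 0)"
    unfolding free_act_def linear_op_zero[OF linear_op_foldr, OF lin] by simp
  then show ?case using rel[OF gen] by (simp add: free_act_mult[OF lin])
next
  case (add s t)
  then show ?case by (simp add: free_act_add fun_eq_iff)
qed


section \<open>The double of the Jordan plane\<close>

datatype jd_gen = U_gen | V_gen | Zeta_gen | G_gen | Ginv_gen | X_gen | Y_gen

definition jd_relations :: "(jd_gen, 'k::field) free_algebra set"
  where "jd_relations =
   (let u = free_gen U_gen; v = free_gen V_gen; \<zeta> = free_gen Zeta_gen;
        g = free_gen G_gen; g' = free_gen Ginv_gen;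
        x = free_gen X_gen; y = free_gen Y_gen; half = free_scalar (1/2)
    in {g * g' - 1, g' * g - 1,
        \<zeta> * g - g * \<zeta>,
        g * x - x * g,
        g * y - (y * g + x * g),
        \<zeta> * y - (y * \<zeta> + y),
        \<zeta> * x - (x * \<zeta> + x),
        u * g - g * u,
        v * g - (g * v + g * u),
        v * \<zeta> - (\<zeta> * v + v),
        u * \<zeta> - (\<zeta> * u + u),
        y * x - (x * y - half * x^2),
        v * u - (u * v - half * u^2),
        u * x - x * u,
        v * x - (x * v + (1 - g) + x * u),
        u * y - (y * u + (1 - g)),
        v * y - (y * v - g * \<zeta> + y * u)})"

quotient_type (overloaded) 'k jordan_double =
    "(jd_gen, 'k::field) free_algebra" / "ideal_cong jd_relations"
  by (rule equivp_ideal_cong)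

lemma jd_one_not_zero: "\<not> ideal_cong jd_relations (0 :: (jd_gen, 'k::field) free_algebra) 1"
proof
  define op :: "jd_gen \<Rightarrow> (unit \<Rightarrow> 'k) \<Rightarrow> unit \<Rightarrow> 'k"
    where "op = (\<lambda>g f. if g = G_gen \<or> g = Ginv_gen then f else (\<lambda>_. 0))"
  have lin: "linear_op (op g)" for g
    by (simp add: op_def linear_op_def)
  have op_app: "op g f = (if g = G_gen \<or> g = Ginv_gen then f else (\<lambda>_. 0))" for g f
    by (simp add: op_def)
  note simps = free_act_add free_act_diff free_act_mult[OF lin] free_act_gen
    free_act_scalar free_act_one power2_eq_square
  assume "ideal_cong jd_relations (0 :: (jd_gen, 'k) free_algebra) 1"
  then have "(1 :: (jd_gen, 'k) free_algebra) \<in> two_sided_ideal jd_relations"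
    using ideal_cong_sym unfolding ideal_cong_def by fastforce
  moreover have rel: "free_act op r f = (\<lambda>i. 0)" if "r \<in> jd_relations" for r f
    using that by (auto simp: jd_relations_def Let_def simps op_app fun_eq_iff)
  ultimately have "free_act op 1 (\<lambda>_. 1) = (\<lambda>i. 0)"
    by (intro free_act_ideal[OF lin rel])
  then show False by (simp add: free_act_one fun_eq_iff)
qed

instantiation jordan_double :: (field) ring_1
begin

lift_definition zero_jordan_double :: "'a jordan_double" is 0 .
lift_definition one_jordan_double :: "'a jordan_double" is 1 .
lift_definition plus_jordan_double :: "'a jordan_double \<Rightarrow> 'a jordan_double \<Rightarrow> 'a jordan_double"
  is "(+)" by (rule ideal_cong_add)
lift_definition uminus_jordan_double :: "'a jordan_double \<Rightarrow> 'a jordan_double"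
  is "uminus" by (rule ideal_cong_uminus)
lift_definition minus_jordan_double :: "'a jordan_double \<Rightarrow> 'a jordan_double \<Rightarrow> 'a jordan_double"
  is "(-)" by (rule ideal_cong_diff)
lift_definition times_jordan_double :: "'a jordan_double \<Rightarrow> 'a jordan_double \<Rightarrow> 'a jordan_double"
  is "(*)" by (rule ideal_cong_mult)

instance
  by (standard; transfer)
     (simp_all add: algebra_simps ideal_cong_refl jd_one_not_zero)

end

lift_definition jd_scalar :: "'k::field \<Rightarrow> 'k jordan_double" is free_scalar .
lift_definition jd_u :: "'k::field jordan_double" is "free_gen U_gen" .
lift_definition jd_v :: "'k::field jordan_double" is "free_gen V_gen" .
lift_definition jd_zeta :: "'k::field jordan_double" is "free_gen Zeta_gen" .
lift_definition jd_g :: "'k::field jordan_double" is "free_gen G_gen" .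
lift_definition jd_ginv :: "'k::field jordan_double" is "free_gen Ginv_gen" .
lift_definition jd_x :: "'k::field jordan_double" is "free_gen X_gen" .
lift_definition jd_y :: "'k::field jordan_double" is "free_gen Y_gen" .

definition jd_q :: "'k::field jordan_double"
  where "jd_q = jd_u * jd_x + 2 * (1 + jd_g)"

definition jd_z :: "'k::field jordan_double"
  where "jd_z = jd_q^2 * jd_ginv"


section \<open>The second Weyl algebra over a commutative ring\<close>

datatype weyl_gen = Q1_gen | Q2_gen | P1_gen | P2_gen

definition weyl_relations :: "(weyl_gen, 'r::comm_ring_1) free_algebra set"
  where "weyl_relations =
   (let q1 = free_gen Q1_gen; q2 = free_gen Q2_gen;
        p1 = free_gen P1_gen; p2 = free_gen P2_gen
    in {p1 * q1 - q1 * p1 - 1, p2 * q2 - q2 * p2 - 1,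
        p1 * q2 - q2 * p1, p2 * q1 - q1 * p2,
        q1 * q2 - q2 * q1, p1 * p2 - p2 * p1})"

quotient_type (overloaded) 'r weyl2 =
    "(weyl_gen, 'r::comm_ring_1) free_algebra" / "ideal_cong weyl_relations"
  by (rule equivp_ideal_cong)

lemma weyl_one_not_zero:
  "\<not> ideal_cong weyl_relations (0 :: (weyl_gen, 'r::comm_ring_1) free_algebra) 1"
proof
  define op :: "weyl_gen \<Rightarrow> (nat \<times> nat \<Rightarrow> 'r) \<Rightarrow> nat \<times> nat \<Rightarrow> 'r"
    where "op = (\<lambda>g f (a, b). case g of
        Q1_gen \<Rightarrow> (if a = 0 then 0 else f (a - 1, b))
      | Q2_gen \<Rightarrow> (if b = 0 then 0 else f (a, b - 1))
      | P1_gen \<Rightarrow> of_nat (Suc a) * f (Suc a, b)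
      | P2_gen \<Rightarrow> of_nat (Suc b) * f (a, Suc b))"
  have lin: "linear_op (op g)" for g
    by (cases g) (auto simp: op_def linear_op_def algebra_simps)
  have op_app: "op g f (a, b) = (case g of
        Q1_gen \<Rightarrow> (if a = 0 then 0 else f (a - 1, b))
      | Q2_gen \<Rightarrow> (if b = 0 then 0 else f (a, b - 1))
      | P1_gen \<Rightarrow> of_nat (Suc a) * f (Suc a, b)
      | P2_gen \<Rightarrow> of_nat (Suc b) * f (a, Suc b))" for g f a b
    by (simp add: op_def)
  note simps = free_act_add free_act_diff free_act_mult[OF lin] free_act_gen
    free_act_scalar free_act_one
  assume "ideal_cong weyl_relations (0 :: (weyl_gen, 'r) free_algebra) 1"
  then have "(1 :: (weyl_gen, 'r) free_algebra) \<in> two_sided_ideal weyl_relations"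
    using ideal_cong_sym unfolding ideal_cong_def by fastforce
  moreover have rel: "free_act op r f = (\<lambda>i. 0)" if "r \<in> weyl_relations" for r f
    using that by (auto simp: weyl_relations_def Let_def simps op_app fun_eq_iff distrib_left distrib_right ac_simps
        split: if_splits)
  ultimately have "free_act op 1 (\<lambda>_. 1) = (\<lambda>i. 0)"
    by (intro free_act_ideal[OF lin rel])
  then show False by (simp add: free_act_one fun_eq_iff)
qed

instantiation weyl2 :: (comm_ring_1) ring_1
begin

lift_definition zero_weyl2 :: "'a weyl2" is 0 .
lift_definition one_weyl2 :: "'a weyl2" is 1 .
lift_definition plus_weyl2 :: "'a weyl2 \<Rightarrow> 'a weyl2 \<Rightarrow> 'a weyl2"
  is "(+)" by (rule ideal_cong_add)
lift_definition uminus_weyl2 :: "'a weyl2 \<Rightarrow> 'a weyl2"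
  is "uminus" by (rule ideal_cong_uminus)
lift_definition minus_weyl2 :: "'a weyl2 \<Rightarrow> 'a weyl2 \<Rightarrow> 'a weyl2"
  is "(-)" by (rule ideal_cong_diff)
lift_definition times_weyl2 :: "'a weyl2 \<Rightarrow> 'a weyl2 \<Rightarrow> 'a weyl2"
  is "(*)" by (rule ideal_cong_mult)

instance
  by (standard; transfer)
     (simp_all add: algebra_simps ideal_cong_refl weyl_one_not_zero)

end

lift_definition weyl_scalar :: "'r::comm_ring_1 \<Rightarrow> 'r weyl2" is free_scalar .
lift_definition weyl_q1 :: "'r::comm_ring_1 weyl2" is "free_gen Q1_gen" .
lift_definition weyl_q2 :: "'r::comm_ring_1 weyl2" is "free_gen Q2_gen" .
lift_definition weyl_p1 :: "'r::comm_ring_1 weyl2" is "free_gen P1_gen" .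
lift_definition weyl_p2 :: "'r::comm_ring_1 weyl2" is "free_gen P2_gen" .


section \<open>Ore localization\<close>

definition is_ring_hom :: "('a::ring_1 \<Rightarrow> 'b::ring_1) \<Rightarrow> bool"
  where "is_ring_hom f \<longleftrightarrow> f 1 = 1 \<and> (\<forall>a b. f (a + b) = f a + f b) \<and> (\<forall>a b. f (a * b) = f a * f b)"

definition invertible_elem :: "'a::ring_1 \<Rightarrow> bool"
  where "invertible_elem a \<longleftrightarrow> (\<exists>b. a * b = 1 \<and> b * a = 1)"

definition ring_inv :: "'a::ring_1 \<Rightarrow> 'a"
  where "ring_inv a = (THE b. a * b = 1 \<and> b * a = 1)"

inductive_set mult_set :: "'a::ring_1 set \<Rightarrow> 'a set" for A :: "'a set"
  where
    one: "1 \<in> mult_set A"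
  | gen: "a \<in> A \<Longrightarrow> a \<in> mult_set A"
  | mult: "s \<in> mult_set A \<Longrightarrow> t \<in> mult_set A \<Longrightarrow> s * t \<in> mult_set A"

text \<open>The ring \<open>'b\<close>, with the map \<open>\<iota>\<close>, is the (two-sided) ring of fractions of \<open>'a\<close> with respect
  to \<open>S\<close>: elements of \<open>S\<close> become invertible, every element is both a right and a left fraction,
  and the kernel is the \<open>S\<close>-torsion. Such a ring exists only if \<open>S\<close> is an Ore set, and it is then
  unique up to a unique isomorphism under \<open>'a\<close>.\<close>

definition is_ore_localization :: "'a::ring_1 set \<Rightarrow> ('a \<Rightarrow> 'b::ring_1) \<Rightarrow> bool"
  where "is_ore_localization S \<iota> \<longleftrightarrow>
    is_ring_hom \<iota> \<and>
    (\<forall>s\<in>S. invertible_elem (\<iota> s)) \<and>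
    (\<forall>b. \<exists>a. \<exists>s\<in>S. b = \<iota> a * ring_inv (\<iota> s)) \<and>
    (\<forall>b. \<exists>a. \<exists>s\<in>S. b = ring_inv (\<iota> s) * \<iota> a) \<and>
    (\<forall>a. \<iota> a = 0 \<longleftrightarrow> (\<exists>s\<in>S. a * s = 0)) \<and>
    (\<forall>a. \<iota> a = 0 \<longleftrightarrow> (\<exists>s\<in>S. s * a = 0))"


section \<open>Centers, subalgebras, algebraic independence\<close>

definition ring_center :: "'a::ring_1 set"
  where "ring_center = {c. \<forall>a. c * a = a * c}"

text \<open>In what follows \<open>\<sigma>\<close> is the structure map of a \<open>'k\<close>-algebra.\<close>

inductive_set generated_subalgebra :: "('k::field \<Rightarrow> 'a::ring_1) \<Rightarrow> 'a set \<Rightarrow> 'a set"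
  for \<sigma> :: "'k \<Rightarrow> 'a" and A :: "'a set"
  where
    scalar: "\<sigma> c \<in> generated_subalgebra \<sigma> A"
  | gen: "a \<in> A \<Longrightarrow> a \<in> generated_subalgebra \<sigma> A"
  | add: "a \<in> generated_subalgebra \<sigma> A \<Longrightarrow> b \<in> generated_subalgebra \<sigma> A \<Longrightarrow>
      a + b \<in> generated_subalgebra \<sigma> A"
  | mult: "a \<in> generated_subalgebra \<sigma> A \<Longrightarrow> b \<in> generated_subalgebra \<sigma> A \<Longrightarrow>
      a * b \<in> generated_subalgebra \<sigma> A"

text \<open>A polynomial in two variables is an element of \<^typ>\<open>'k poly poly\<close>.\<close>

definition eval_poly2 :: "('k::field \<Rightarrow> 'a::ring_1) \<Rightarrow> 'a \<Rightarrow> 'a \<Rightarrow> 'k poly poly \<Rightarrow> 'a"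
  where "eval_poly2 \<sigma> a b P =
    (\<Sum>i\<le>degree P. \<Sum>j\<le>degree (coeff P i). \<sigma> (coeff (coeff P i) j) * a ^ i * b ^ j)"

definition algebraically_independent2 :: "('k::field \<Rightarrow> 'a::ring_1) \<Rightarrow> 'a \<Rightarrow> 'a \<Rightarrow> bool"
  where "algebraically_independent2 \<sigma> a b \<longleftrightarrow>
    a * b = b * a \<and> (\<forall>P. eval_poly2 \<sigma> a b P = 0 \<longrightarrow> P = 0)"


section \<open>The localized double and its center\<close>

text \<open>The element \<open>z'\<close> of a localization \<open>\<iota>\<close> of the double in which \<open>q\<close> becomes invertible.\<close>

definition jd_z' :: "('k::field jordan_double \<Rightarrow> 'd::ring_1) \<Rightarrow> 'd"
  where "jd_z' \<iota> = ring_inv (\<iota> jd_q) *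
    \<iota> (jd_x * jd_v + jd_u * jd_y
       + (- (jd_scalar (1/2) * jd_u * jd_x) + jd_g - 1) * jd_zeta
       - 2 * (1 + jd_g))"

text \<open>The ring \<open>k[Z\<^sup>\<plusminus>\<^sup>1, Z']\<close>, as the group algebra of the integers over \<open>k[Z']\<close>.\<close>

type_synonym 'k laurent_ring = "int \<Rightarrow>\<^sub>0 'k poly"

definition laurent_const :: "'k::field \<Rightarrow> 'k laurent_ring"
  where "laurent_const c = Poly_Mapping.single 0 [:c:]"

definition laurent_Z :: "'k::field laurent_ring"
  where "laurent_Z = Poly_Mapping.single 1 1"

definition laurent_Z' :: "'k::field laurent_ring"
  where "laurent_Z' = Poly_Mapping.single 0 [:0, 1:]"

end

theory Submission
  imports Defs
begin

text \<open>
  In \<open>D'\<close> put \<open>q\<^sub>1 = x\<close>, \<open>q\<^sub>2 = q\<close>, \<open>p\<^sub>1 = x\<^sup>-\<^sup>1 \<zeta>\<close> and \<open>p\<^sub>2 = - x\<^sup>-\<^sup>1 q\<^sup>-\<^sup>1 (2 y + x \<zeta>)\<close>; these satisfy the Weyl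
  relations and commute with \<open>z\<close> and \<open>z'\<close>, which yields a homomorphism \<open>\<Psi> : A\<^sub>2'(S) \<rightarrow> D'\<close>.
  Conversely \<open>g = z\<^sup>-\<^sup>1 q\<^sup>2\<close>, \<open>u = (q - 2 (1 + g)) x\<^sup>-\<^sup>1\<close>, \<open>\<zeta> = x p\<^sub>1\<close> and
  \<open>y = - (x q p\<^sub>2 + x\<^sup>2 p\<^sub>1) / 2\<close>, and then the definition of \<open>z'\<close> can be solved for \<open>v\<close>;
  read in \<open>A\<^sub>2'(S)\<close> these formulas satisfy the relations of the double and yield
  \<open>\<Phi> : D' \<rightarrow> A\<^sub>2'(S)\<close>, inverse to \<open>\<Psi>\<close>. Since only the universal properties of presentations
  and of Ore localizations enter, no PBW basis is needed. Algebraic independence and the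
  center are read off from \<open>A\<^sub>2'(S)\<close>: scalars act faithfully on polynomials, and an element
  commuting with \<open>q\<^sub>i\<close> and \<open>p\<^sub>i\<close> involves, in characteristic 0, neither \<open>p\<^sub>i\<close> nor \<open>q\<^sub>i\<close>.
\<close>

section \<open>Ring homomorphisms and inverses\<close>

lemma ring_hom_one: "is_ring_hom f \<Longrightarrow> f 1 = 1"
  and ring_hom_add: "is_ring_hom f \<Longrightarrow> f (a + b) = f a + f b"
  and ring_hom_mult: "is_ring_hom f \<Longrightarrow> f (a * b) = f a * f b"
  by (simp_all add: is_ring_hom_def)

lemma ring_hom_zero: "is_ring_hom f \<Longrightarrow> f 0 = 0"
  using ring_hom_add[of f 0 0] by simp

lemma ring_hom_minus: "is_ring_hom f \<Longrightarrow> f (- a) = - f a"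
  using ring_hom_add[of f a "- a"] by (simp add: ring_hom_zero eq_neg_iff_add_eq_0 add.commute)

lemma ring_hom_diff: "is_ring_hom f \<Longrightarrow> f (a - b) = f a - f b"
  using ring_hom_add[of f a "- b"] by (simp add: ring_hom_minus)

lemma ring_hom_power: "is_ring_hom f \<Longrightarrow> f (a ^ n) = f a ^ n"
  by (induction n) (simp_all add: ring_hom_one ring_hom_mult)

lemma ring_hom_sum: "is_ring_hom f \<Longrightarrow> f (\<Sum>i\<in>A. g i) = (\<Sum>i\<in>A. f (g i))"
  by (induction A rule: infinite_finite_induct) (simp_all add: ring_hom_zero ring_hom_add)

lemma ring_hom_numeral: "is_ring_hom f \<Longrightarrow> f (numeral n) = numeral n"
  by (induction n) (simp_all only: numeral.simps ring_hom_one ring_hom_add)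

lemma ring_hom_of_nat: "is_ring_hom f \<Longrightarrow> f (of_nat n) = of_nat n"
  by (induction n) (simp_all add: ring_hom_zero ring_hom_one ring_hom_add)

lemma ring_hom_of_int: "is_ring_hom f \<Longrightarrow> f (of_int n) = of_int n"
  by (cases n rule: int_cases2) (simp_all add: ring_hom_minus ring_hom_of_nat)

lemmas ring_hom_simps = ring_hom_one ring_hom_add ring_hom_mult ring_hom_zero ring_hom_minus
  ring_hom_diff ring_hom_power ring_hom_sum ring_hom_numeral

lemma ring_hom_comp: "is_ring_hom f \<Longrightarrow> is_ring_hom g \<Longrightarrow> is_ring_hom (f \<circ> g)"
  by (simp add: is_ring_hom_def)

lemma ring_inv_eqI:
  assumes "a * b = 1" "b * a = 1"
  shows "ring_inv a = b"
  unfolding ring_inv_def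
proof (rule the_equality)
  fix c assume "a * c = 1 \<and> c * a = 1"
  then have "c = (b * a) * c" "b = b * (a * c)" using assms by simp_all
  then show "c = b" by (simp add: mult.assoc)
qed (use assms in simp)

lemma ring_inv_inverse:
  assumes "invertible_elem a"
  shows "a * ring_inv a = 1" "ring_inv a * a = 1"
proof -
  obtain b where "a * b = 1" "b * a = 1"
    using assms by (auto simp: invertible_elem_def)
  then show "a * ring_inv a = 1" "ring_inv a * a = 1"
    using ring_inv_eqI by blast+
qed

lemma invertible_elemI: "a * b = 1 \<Longrightarrow> b * a = 1 \<Longrightarrow> invertible_elem a"
  by (auto simp: invertible_elem_def)

lemma invertible_elem_one: "invertible_elem 1"
  by (rule invertible_elemI[of _ 1]) simp_all

lemma invertible_elem_mult:
  assumes "invertible_elem a" "invertible_elem b"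
  shows "invertible_elem (a * b)"
proof (rule invertible_elemI[of _ "ring_inv b * ring_inv a"])
  have "a * b * (ring_inv b * ring_inv a) = a * (b * ring_inv b) * ring_inv a"
    by (simp only: mult.assoc)
  then show "a * b * (ring_inv b * ring_inv a) = 1" using assms by (simp add: ring_inv_inverse)
  have "ring_inv b * ring_inv a * (a * b) = ring_inv b * (ring_inv a * a) * b"
    by (simp only: mult.assoc)
  then show "ring_inv b * ring_inv a * (a * b) = 1" using assms by (simp add: ring_inv_inverse)
qed

lemma invertible_elem_cancel_left:
  assumes "invertible_elem (a :: 'a::ring_1)"
  shows "a * b = a * c \<longleftrightarrow> b = c"
proof
  assume "a * b = a * c"
  then have "ring_inv a * a * b = ring_inv a * a * c" by (simp only: mult.assoc)
  then show "b = c" using assms by (simp add: ring_inv_inverse)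
qed simp

lemma invertible_elem_cancel_right:
  assumes "invertible_elem (a :: 'a::ring_1)"
  shows "b * a = c * a \<longleftrightarrow> b = c"
proof
  assume "b * a = c * a"
  then have "b * (a * ring_inv a) = c * (a * ring_inv a)" by (simp only: mult.assoc[symmetric])
  then show "b = c" using assms by (simp add: ring_inv_inverse)
qed simp

lemma ring_hom_invertible: "is_ring_hom f \<Longrightarrow> invertible_elem a \<Longrightarrow> invertible_elem (f a)"
  unfolding invertible_elem_def by (metis ring_hom_mult ring_hom_one)

lemma ring_hom_ring_inv:
  assumes "is_ring_hom f" "invertible_elem a"
  shows "f (ring_inv a) = ring_inv (f a)"
  using assms by (intro ring_inv_eqI[symmetric])
    (simp_all add: ring_hom_mult[symmetric] ring_inv_inverse ring_hom_one)

lemma mult_set_invertible: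
  assumes "is_ring_hom f" "\<And>a. a \<in> A \<Longrightarrow> invertible_elem (f a)" "s \<in> mult_set A"
  shows "invertible_elem (f s)"
  using assms(3)
  by (induction rule: mult_set.induct)
     (simp_all add: assms ring_hom_one ring_hom_mult invertible_elem_one invertible_elem_mult)

lemma commutes_inverse:
  assumes "a * b = (1 :: 'a::ring_1)" "b * a = 1" "c * a = a * c"
  shows "c * b = b * c"
proof -
  have "c * b = b * (a * c) * b" using assms(2) by (simp add: mult.assoc[symmetric])
  also have "\<dots> = b * (c * a) * b" using assms(3) by simp
  also have "\<dots> = b * c * (a * b)" by (simp only: mult.assoc)
  also have "\<dots> = b * c" using assms(1) by simp
  finally show ?thesis .
qed

text \<open>A rewrite rule for two adjacent letters is extended to act inside a right-associated
  word, as needed for the normal forms below.\<close>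

lemma mult_assoc_rule: "a * b = c \<Longrightarrow> a * (b * d) = c * (d :: 'a::ring_1)"
  by (simp add: mult.assoc[symmetric])

section \<open>The universal property of an Ore localization\<close>

context
  fixes S :: "'a::ring_1 set" and \<iota> :: "'a \<Rightarrow> 'b::ring_1"
  assumes loc: "is_ore_localization S \<iota>"
begin

lemma ore_hom: "is_ring_hom \<iota>"
  and ore_invertible: "s \<in> S \<Longrightarrow> invertible_elem (\<iota> s)"
  and ore_kernel: "\<iota> a = 0 \<longleftrightarrow> (\<exists>s\<in>S. a * s = 0)"
  using loc by (simp_all add: is_ore_localization_def)

lemma ore_right_fraction:
  obtains a s where "s \<in> S" "b * \<iota> s = \<iota> a"
proof -
  obtain a s where "s \<in> S" "b = \<iota> a * ring_inv (\<iota> s)"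
    using loc unfolding is_ore_localization_def by blast
  moreover from this have "b * \<iota> s = \<iota> a"
    by (simp add: mult.assoc ring_inv_inverse ore_invertible)
  ultimately show ?thesis using that by blast
qed

lemma ore_left_fraction:
  obtains a s where "s \<in> S" "\<iota> s * b = \<iota> a"
proof -
  obtain a s where "s \<in> S" "b = ring_inv (\<iota> s) * \<iota> a"
    using loc unfolding is_ore_localization_def by blast
  moreover from this have "\<iota> s * b = \<iota> a"
    by (simp add: mult.assoc[symmetric] ring_inv_inverse ore_invertible)
  ultimately show ?thesis using that by blast
qed

text \<open>Multiplication by the image of a right denominator, which is invertible, reduces
  equality at \<open>b\<close> to equality on the image of \<open>\<iota>\<close>.\<close>

lemma ore_hom_unique:
  fixes F G :: "'b \<Rightarrow> 'c::ring_1"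
  assumes F: "is_ring_hom F" and G: "is_ring_hom G" and eq: "\<And>a. F (\<iota> a) = G (\<iota> a)"
  shows "F = G"
proof
  fix b
  obtain a s where s: "s \<in> S" "b * \<iota> s = \<iota> a" by (rule ore_right_fraction)
  have "F b * F (\<iota> s) = F (\<iota> a)" "G b * G (\<iota> s) = G (\<iota> a)"
    using F G s(2) by (metis ring_hom_mult)+
  then have "F b * F (\<iota> s) = G b * F (\<iota> s)" by (simp add: eq)
  then show "F b = G b"
    using invertible_elem_cancel_right ring_hom_invertible[OF F ore_invertible[OF s(1)]] by blast
qed

text \<open>\<open>F b\<close> is the value \<open>f a * ring_inv (f s)\<close> of any right
  fraction representing \<open>b\<close>. All right fractions of \<open>b\<close> are compared with
  a single left fraction of \<open>b\<close>; this makes the value well defined without a search for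
  common denominators.\<close>

lemma ore_extend:
  fixes f :: "'a \<Rightarrow> 'c::ring_1"
  assumes f: "is_ring_hom f" and inv: "\<And>s. s \<in> S \<Longrightarrow> invertible_elem (f s)"
  obtains F where "is_ring_hom F" "\<And>a. F (\<iota> a) = f a"
proof -
  note h = ring_hom_simps[OF f] ring_hom_simps[OF ore_hom]
  \<comment> \<open>Elements with the same image differ by S-torsion, and \<open>f\<close> kills
    this torsion because \<open>f s\<close> is invertible.\<close>
  have ker: "f a = f b" if eq: "\<iota> a = \<iota> b" for a b
  proof -
    have "\<iota> (a - b) = 0" using eq by (simp add: h)
    then obtain s where "s \<in> S" "(a - b) * s = 0" using ore_kernel by blast
    then have "f a * f s = f b * f s" using h(3) by (metis eq_iff_diff_eq_0 left_diff_distrib)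
    then show ?thesis using inv[OF \<open>s \<in> S\<close>] by (simp add: invertible_elem_cancel_right)
  qed
  \<comment> \<open>A left fraction with denominator \<open>r\<close> and numerator \<open>d\<close>
    and a right fraction with numerator \<open>a\<close> and denominator \<open>s\<close> of the
    same \<open>b\<close> satisfy \<open>\<iota> (r * a) = \<iota> (d * s)\<close>; applying
    \<open>f\<close> and cancelling \<open>f s\<close> relates their values.\<close>
  have link: "f r * w = f d"
    if "r \<in> S" "\<iota> r * b = \<iota> d" "s \<in> S" "b * \<iota> s = \<iota> a" "w * f s = f a" for r d s a b w
  proof -
    have "\<iota> (r * a) = \<iota> r * b * \<iota> s" using that(4) by (simp add: h mult.assoc)
    then have "\<iota> (r * a) = \<iota> (d * s)" using that(2) by (simp only: h)
    then have "f r * w * f s = f d * f s" using ker that(5) by (metis h(3) mult.assoc)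
    then show ?thesis using inv[OF \<open>s \<in> S\<close>] by (simp add: invertible_elem_cancel_right)
  qed
  have ex: "\<exists>w. \<forall>s\<in>S. \<forall>a. b * \<iota> s = \<iota> a \<longrightarrow> w * f s = f a" for b
  proof -
    obtain r d where r: "r \<in> S" "\<iota> r * b = \<iota> d" by (rule ore_left_fraction)
    have "ring_inv (f r) * f d * f s = f a" if s: "s \<in> S" "b * \<iota> s = \<iota> a" for s a
    proof -
      have "f a * ring_inv (f s) * f s = f a"
        using inv[OF s(1)] by (simp add: mult.assoc ring_inv_inverse)
      from link[OF r s this] have "f r * (f a * ring_inv (f s)) = f d" .
      then have "ring_inv (f r) * f d * f s
          = (ring_inv (f r) * f r) * f a * (ring_inv (f s) * f s)"
        by (metis mult.assoc)
      then show ?thesis using inv r(1) s(1) by (simp add: ring_inv_inverse)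
    qed
    then show ?thesis by blast
  qed
  then obtain F where F: "\<And>b s a. s \<in> S \<Longrightarrow> b * \<iota> s = \<iota> a \<Longrightarrow> F b * f s = f a"
    by metis
  have F_left: "f r * F b = f d" if "r \<in> S" "\<iota> r * b = \<iota> d" for r b d
  proof -
    obtain a s where s: "s \<in> S" "b * \<iota> s = \<iota> a" by (rule ore_right_fraction)
    show ?thesis by (rule link[OF that s F[OF s]])
  qed
  \<comment> \<open>Products and sums are treated first with the left argument in the image of
    \<open>\<iota>\<close>. The general case follows on multiplying by a left denominator of that
    argument.\<close>
  have F_mult_left: "F (\<iota> c * b) = f c * F b" for c b
  proof -
    obtain a s where s: "s \<in> S" "b * \<iota> s = \<iota> a" by (rule ore_right_fraction)
    then have "\<iota> c * b * \<iota> s = \<iota> (c * a)" by (simp add: h mult.assoc)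
    from F[OF s(1) this] F[OF s] have "F (\<iota> c * b) * f s = f c * F b * f s"
      by (simp add: h mult.assoc)
    then show ?thesis using inv[OF s(1)] by (simp add: invertible_elem_cancel_right)
  qed
  have F_add_left: "F (\<iota> c + b) = f c + F b" for c b
  proof -
    obtain a s where s: "s \<in> S" "b * \<iota> s = \<iota> a" by (rule ore_right_fraction)
    then have "(\<iota> c + b) * \<iota> s = \<iota> (c * s + a)" by (simp add: h distrib_right)
    from F[OF s(1) this] F[OF s] have "F (\<iota> c + b) * f s = (f c + F b) * f s"
      by (simp add: h distrib_right)
    then show ?thesis using inv[OF s(1)] by (simp add: invertible_elem_cancel_right)
  qed
  have ext: "F (\<iota> a) = f a" for a
  proof -
    obtain c s where s: "s \<in> S" "\<iota> a * \<iota> s = \<iota> c" by (rule ore_right_fraction)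
    have "\<iota> a * \<iota> s = \<iota> (a * s)" by (simp add: h)
    from F[OF s(1) this] have "F (\<iota> a) * f s = f a * f s" by (simp add: h)
    then show ?thesis using inv[OF s(1)] by (simp add: invertible_elem_cancel_right)
  qed
  have mult: "F (b * b') = F b * F b'" for b b'
  proof -
    obtain d r where r: "r \<in> S" "\<iota> r * b = \<iota> d" by (rule ore_left_fraction)
    have "f r * F (b * b') = F (\<iota> d * b')"
      by (simp add: F_mult_left[symmetric] r(2)[symmetric] mult.assoc)
    also have "\<dots> = f r * (F b * F b')"
      by (simp add: F_mult_left F_left[OF r, symmetric] mult.assoc)
    finally show ?thesis using inv[OF r(1)] by (simp add: invertible_elem_cancel_left)
  qed
  have add: "F (b + b') = F b + F b'" for b b'
  proof -
    obtain d r where r: "r \<in> S" "\<iota> r * b = \<iota> d" by (rule ore_left_fraction)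
    have "f r * F (b + b') = F (\<iota> d + \<iota> r * b')"
      by (simp add: F_mult_left[symmetric] r(2)[symmetric] distrib_left)
    also have "\<dots> = f r * (F b + F b')"
      by (simp add: F_add_left F_mult_left F_left[OF r, symmetric] distrib_left)
    finally show ?thesis using inv[OF r(1)] by (simp add: invertible_elem_cancel_left)
  qed
  have "is_ring_hom F"
    using ext[of 1] mult add by (simp add: is_ring_hom_def h)
  then show ?thesis using ext by (rule that)
qed

end

section \<open>Evaluation of monoid algebras and polynomials\<close>

text \<open>Used for two monoids: words, which gives evaluation on free algebras, and the integers,
  which gives evaluation of Laurent polynomials.\<close>

definition monoid_eval :: "('r::comm_ring_1 \<Rightarrow> 'a::ring_1) \<Rightarrow> ('m \<Rightarrow> 'a) \<Rightarrow> ('m \<Rightarrow>\<^sub>0 'r) \<Rightarrow> 'a"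
  where "monoid_eval \<rho> \<mu> F =
    (\<Sum>m\<in>Poly_Mapping.keys F. \<rho> (Poly_Mapping.lookup F m) * \<mu> m)"

context
  fixes \<rho> :: "'r::comm_ring_1 \<Rightarrow> 'a::ring_1" and \<mu> :: "'m::monoid_add \<Rightarrow> 'a"
  assumes \<rho>: "is_ring_hom \<rho>"
begin

lemma monoid_eval_superset:
  assumes "finite A" "Poly_Mapping.keys F \<subseteq> A"
  shows "monoid_eval \<rho> \<mu> F = (\<Sum>m\<in>A. \<rho> (Poly_Mapping.lookup F m) * \<mu> m)"
  unfolding monoid_eval_def using assms
  by (intro sum.mono_neutral_left) (auto simp: in_keys_iff ring_hom_zero[OF \<rho>])

lemma monoid_eval_add: "monoid_eval \<rho> \<mu> (F + G) = monoid_eval \<rho> \<mu> F + monoid_eval \<rho> \<mu> G"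
proof -
  let ?A = "Poly_Mapping.keys F \<union> Poly_Mapping.keys G"
  have "Poly_Mapping.keys (F + G) \<subseteq> ?A" by (rule Poly_Mapping.keys_add)
  then show ?thesis
    by (simp add: monoid_eval_superset[of ?A] lookup_add ring_hom_add[OF \<rho>] distrib_right
        sum.distrib)
qed

lemma monoid_eval_sum:
  "monoid_eval \<rho> \<mu> (\<Sum>a\<in>A. F a) = (\<Sum>a\<in>A. monoid_eval \<rho> \<mu> (F a))"
proof (induction A rule: infinite_finite_induct)
  case empty
  then show ?case by (simp add: monoid_eval_def)
next
  case (infinite A)
  then show ?case by (simp add: monoid_eval_def)
qed (simp add: monoid_eval_add)

lemma monoid_eval_single: "monoid_eval \<rho> \<mu> (Poly_Mapping.single m c) = \<rho> c * \<mu> m"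
  by (simp add: monoid_eval_superset[of "{m}"])

lemma monoid_eval_hom:
  assumes "\<mu> 0 = 1" "\<And>m n. \<mu> (m + n) = \<mu> m * \<mu> n" "\<And>c m. \<rho> c * \<mu> m = \<mu> m * \<rho> c"
  shows "is_ring_hom (monoid_eval \<rho> \<mu>)"
proof -
  let ?S = "Poly_Mapping.single" and ?l = "Poly_Mapping.lookup"
  have comm: "\<rho> (c * d) * (\<mu> m * \<mu> n) = \<rho> c * \<mu> m * (\<rho> d * \<mu> n)" for c d m n
    using assms(3)[of d m] by (simp add: ring_hom_mult[OF \<rho>]) (metis mult.assoc)
  have "monoid_eval \<rho> \<mu> (F * G) = monoid_eval \<rho> \<mu> F * monoid_eval \<rho> \<mu> G" for F G
  proof -
    have "F * G = (\<Sum>u\<in>Poly_Mapping.keys F. \<Sum>v\<in>Poly_Mapping.keys G.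
        ?S u (?l F u) * ?S v (?l G v))"
      by (subst poly_mapping_expand[of F], subst poly_mapping_expand[of G])
         (simp only: sum_product)
    then show ?thesis
      by (simp add: monoid_eval_sum mult_single monoid_eval_single assms(2) comm)
         (simp add: monoid_eval_def sum_product)
  qed
  then show ?thesis
    using monoid_eval_single[of 0 1]
    by (simp add: is_ring_hom_def monoid_eval_add assms(1) ring_hom_one[OF \<rho>])
qed

end

text \<open>Horner evaluation as in \<open>poly\<close>, but with values in a noncommutative ring
  that receives the coefficients through \<open>\<sigma>\<close>.\<close>

definition ring_poly_eval :: "('r::comm_ring_1 \<Rightarrow> 'a::ring_1) \<Rightarrow> 'a \<Rightarrow> 'r poly \<Rightarrow> 'a"
  where "ring_poly_eval \<sigma> b p = fold_coeffs (\<lambda>c r. \<sigma> c + b * r) p 0"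

context
  fixes \<sigma> :: "'r::comm_ring_1 \<Rightarrow> 'a::ring_1" and b :: 'a
  assumes \<sigma>: "is_ring_hom \<sigma>" and comm: "\<And>c. \<sigma> c * b = b * \<sigma> c"
begin

lemma ring_poly_eval_zero: "ring_poly_eval \<sigma> b 0 = 0"
  by (simp add: ring_poly_eval_def)

lemma ring_poly_eval_pCons: "ring_poly_eval \<sigma> b (pCons c p) = \<sigma> c + b * ring_poly_eval \<sigma> b p"
  by (cases "p = 0 \<and> c = 0") (auto simp: ring_poly_eval_def ring_hom_zero[OF \<sigma>])

lemma ring_poly_eval_add:
  "ring_poly_eval \<sigma> b (p + q) = ring_poly_eval \<sigma> b p + ring_poly_eval \<sigma> b q"
  by (induction p q rule: poly_induct2)
     (simp_all add: ring_poly_eval_zero ring_poly_eval_pCons ring_hom_add[OF \<sigma>] algebra_simps)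

lemma ring_poly_eval_smult: "ring_poly_eval \<sigma> b (smult c p) = \<sigma> c * ring_poly_eval \<sigma> b p"
proof (induction p)
  case (pCons d p)
  have "b * (\<sigma> c * ring_poly_eval \<sigma> b p) = \<sigma> c * (b * ring_poly_eval \<sigma> b p)"
    by (simp add: mult.assoc[symmetric] comm)
  then show ?case
    using pCons by (simp add: ring_poly_eval_pCons ring_hom_mult[OF \<sigma>] distrib_left)
qed (simp add: ring_poly_eval_zero)

lemma ring_poly_eval_hom: "is_ring_hom (ring_poly_eval \<sigma> b)"
proof -
  have "ring_poly_eval \<sigma> b (p * q) = ring_poly_eval \<sigma> b p * ring_poly_eval \<sigma> b q" for p q
    by (induction p)
       (simp_all add: ring_poly_eval_zero ring_poly_eval_pCons ring_poly_eval_add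
         ring_poly_eval_smult distrib_right mult.assoc ring_hom_zero[OF \<sigma>])
  then show ?thesis
    unfolding is_ring_hom_def one_pCons
    by (simp add: ring_poly_eval_zero ring_poly_eval_pCons ring_poly_eval_add ring_hom_one[OF \<sigma>])
qed

lemma ring_poly_eval_commutes:
  assumes "\<And>c. \<sigma> c * e = e * \<sigma> c" "b * e = e * b"
  shows "ring_poly_eval \<sigma> b p * e = e * ring_poly_eval \<sigma> b p"
proof (induction p)
  case (pCons c p)
  have "b * ring_poly_eval \<sigma> b p * e = e * (b * ring_poly_eval \<sigma> b p)"
    by (metis assms(2) mult.assoc pCons.IH)
  then show ?case by (simp add: ring_poly_eval_pCons distrib_left distrib_right assms(1))
qed (simp add: ring_poly_eval_zero)

end

text \<open>Integer powers of a unit \<open>a\<close>; the second argument is meant to be its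
  inverse, given explicitly.\<close>

definition unit_power :: "'a::ring_1 \<Rightarrow> 'a \<Rightarrow> int \<Rightarrow> 'a"
  where "unit_power a a' n = (if n \<ge> 0 then a ^ nat n else a' ^ nat (- n))"

context
  fixes a a' :: "'a::ring_1"
  assumes inv: "a * a' = 1" "a' * a = 1"
begin

lemma unit_power_simps:
  "unit_power a a' 0 = 1" "unit_power a a' 1 = a" "unit_power a a' (-1) = a'"
  by (simp_all add: unit_power_def)

lemma unit_power_Suc: "unit_power a a' (n + 1) = a * unit_power a a' n"
proof (cases "n \<ge> 0")
  case True
  then show ?thesis by (simp add: unit_power_def nat_add_distrib)
next
  case False
  then obtain k where k: "n = - int (Suc k)" by (metis int_cases not_le of_nat_0_le_iff)
  have "a * a' ^ Suc k = a' ^ k"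
    using inv by (simp add: mult.assoc[symmetric])
  moreover have "unit_power a a' n = a' ^ Suc k" by (simp add: unit_power_def k nat_add_distrib)
  moreover have "unit_power a a' (n + 1) = a' ^ k" by (simp add: unit_power_def k)
  ultimately show ?thesis by simp
qed

lemma unit_power_pred: "unit_power a a' (n - 1) = a' * unit_power a a' n"
  using unit_power_Suc[of "n - 1"] inv by (simp add: mult.assoc[symmetric])

lemma unit_power_add: "unit_power a a' (m + n) = unit_power a a' m * unit_power a a' n"
proof (induction m rule: int_induct[where k = 0])
  case (step1 i)
  then show ?case using unit_power_Suc[of "i + n"] unit_power_Suc[of i]
    by (simp add: algebra_simps)
next
  case (step2 i)
  then show ?case using unit_power_pred[of "i + n"] unit_power_pred[of i]
    by (simp add: algebra_simps)
qed (simp add: unit_power_simps)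

end

lemma unit_power_commutes:
  assumes "a * e = e * a" "a' * e = e * a'"
  shows "unit_power a a' n * e = e * unit_power a a' n"
  using assms by (simp add: unit_power_def power_commuting_commutes)

section \<open>Homomorphisms out of the presented algebras\<close>

lemma free_scalar_commute: "free_scalar c * F = F * (free_scalar c :: ('g, 'r::comm_ring_1) free_algebra)"
proof -
  have "free_scalar c * Poly_Mapping.single m d = Poly_Mapping.single m d * free_scalar c"
    for m :: "'g free_monoid" and d :: 'r
    by (simp add: free_scalar_def mult_single mult.commute)
  then show ?thesis
    by (subst (1 2) poly_mapping_expand[of F]) (simp add: sum_distrib_left sum_distrib_right)
qed

text \<open>A word is a product of generators, and every element is a finite sum of words with
  coefficients.\<close>

lemma free_algebra_induct [case_names scalar gen add mult]:
  fixes P :: "('g, 'r::comm_ring_1) free_algebra \<Rightarrow> bool"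
  assumes "\<And>c. P (free_scalar c)" "\<And>g. P (free_gen g)"
    and add: "\<And>F G. P F \<Longrightarrow> P G \<Longrightarrow> P (F + G)" and mult: "\<And>F G. P F \<Longrightarrow> P G \<Longrightarrow> P (F * G)"
  shows "P F"
proof -
  have word: "P (Poly_Mapping.single (Free_Word ws) c)" for ws c
  proof (induction ws)
    case Nil
    then show ?case using assms(1)[of c] by (simp add: free_scalar_def zero_free_monoid_def)
  next
    case (Cons g ws)
    have "Poly_Mapping.single (Free_Word (g # ws)) c
        = free_gen g * Poly_Mapping.single (Free_Word ws) c"
      by (simp add: free_gen_def mult_single plus_free_monoid_def)
    then show ?case using mult[OF assms(2) Cons] by simp
  qed
  have zero: "P 0" using assms(1)[of 0] by (simp add: free_scalar_def)
  have "P (\<Sum>m\<in>A. Poly_Mapping.single m (h m))" for A and h :: "'g free_monoid \<Rightarrow> 'r"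
  proof (induction A rule: infinite_finite_induct)
    case (insert m A)
    then show ?case using add[OF word[of "letters m"]] by simp
  qed (simp_all add: zero)
  then show ?thesis by (subst poly_mapping_expand[of F])
qed

definition free_eval :: "('r::comm_ring_1 \<Rightarrow> 'a::ring_1) \<Rightarrow> ('g \<Rightarrow> 'a) \<Rightarrow> ('g, 'r) free_algebra \<Rightarrow> 'a"
  where "free_eval \<rho> e = monoid_eval \<rho> (\<lambda>w. prod_list (map e (letters w)))"

context
  fixes \<rho> :: "'r::comm_ring_1 \<Rightarrow> 'a::ring_1" and e :: "'g \<Rightarrow> 'a"
  assumes \<rho>: "is_ring_hom \<rho>" and comm: "\<And>c g. \<rho> c * e g = e g * \<rho> c"
begin

lemma free_eval_hom: "is_ring_hom (free_eval \<rho> e)"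
  unfolding free_eval_def
proof (rule monoid_eval_hom[OF \<rho>])
  fix c and w :: "'g free_monoid"
  have "\<rho> c * prod_list (map e ws) = prod_list (map e ws) * \<rho> c" for ws
    by (induction ws) (simp_all, metis comm mult.assoc)
  then show "\<rho> c * prod_list (map e (letters w)) = prod_list (map e (letters w)) * \<rho> c" .
qed simp_all

lemma free_eval_gen: "free_eval \<rho> e (free_gen g) = e g"
  by (simp add: free_eval_def free_gen_def monoid_eval_single[OF \<rho>] ring_hom_one[OF \<rho>])

lemma free_eval_scalar: "free_eval \<rho> e (free_scalar c) = \<rho> c"
  by (simp add: free_eval_def free_scalar_def monoid_eval_single[OF \<rho>])

lemma free_eval_ideal_cong:
  assumes "\<And>r. r \<in> R \<Longrightarrow> free_eval \<rho> e r = 0" "ideal_cong R F G"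
  shows "free_eval \<rho> e F = free_eval \<rho> e G"
proof -
  have "free_eval \<rho> e s = 0" if "s \<in> two_sided_ideal R" for s
    using that by (induction rule: two_sided_ideal.induct)
      (simp_all add: ring_hom_simps[OF free_eval_hom] assms(1))
  then have "free_eval \<rho> e (F - G) = 0" using assms(2) by (simp add: ideal_cong_def)
  then show ?thesis by (simp add: ring_hom_simps[OF free_eval_hom])
qed

end

lemma jd_scalar_hom: "is_ring_hom (jd_scalar :: 'k::field \<Rightarrow> _)"
proof -
  have "jd_scalar 1 = (1 :: 'k jordan_double)"
    by transfer (simp add: free_scalar_def single_one ideal_cong_refl)
  moreover have "jd_scalar (a + b) = jd_scalar a + jd_scalar b" for a b :: 'k
    by transfer (simp add: free_scalar_def single_add ideal_cong_refl)
  moreover have "jd_scalar (a * b) = jd_scalar a * jd_scalar b" for a b :: 'k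
    by transfer (simp add: free_scalar_def mult_single ideal_cong_refl)
  ultimately show ?thesis by (simp add: is_ring_hom_def)
qed

lemma jd_scalar_commute: "jd_scalar c * a = a * jd_scalar c"
  by transfer (simp add: free_scalar_commute ideal_cong_refl)

lemma weyl_scalar_hom: "is_ring_hom (weyl_scalar :: 'r::comm_ring_1 \<Rightarrow> _)"
proof -
  have "weyl_scalar 1 = (1 :: 'r weyl2)"
    by transfer (simp add: free_scalar_def single_one ideal_cong_refl)
  moreover have "weyl_scalar (a + b) = weyl_scalar a + weyl_scalar b" for a b :: 'r
    by transfer (simp add: free_scalar_def single_add ideal_cong_refl)
  moreover have "weyl_scalar (a * b) = weyl_scalar a * weyl_scalar b" for a b :: 'r
    by transfer (simp add: free_scalar_def mult_single ideal_cong_refl)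
  ultimately show ?thesis by (simp add: is_ring_hom_def)
qed

lemma weyl_scalar_commute: "weyl_scalar c * a = a * weyl_scalar c"
  by transfer (simp add: free_scalar_commute ideal_cong_refl)

lemma jd_induct [case_names scalar u v zeta g ginv x y add mult]:
  fixes P :: "'k::field jordan_double \<Rightarrow> bool"
  assumes "\<And>c. P (jd_scalar c)" "P jd_u" "P jd_v" "P jd_zeta" "P jd_g" "P jd_ginv" "P jd_x" "P jd_y"
    and "\<And>a b. P a \<Longrightarrow> P b \<Longrightarrow> P (a + b)" "\<And>a b. P a \<Longrightarrow> P b \<Longrightarrow> P (a * b)"
  shows "P a"
proof (induct a rule: jordan_double.abs_induct)
  fix F :: "(jd_gen, 'k) free_algebra"
  show "P (abs_jordan_double F)"
  proof (induction F rule: free_algebra_induct)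
    case (scalar c)
    then show ?case using assms(1) by (simp add: jd_scalar.abs_eq)
  next
    case (gen g)
    then show ?case using assms(2-8)
      by (cases g) (simp_all add: jd_u_def jd_v_def jd_zeta_def jd_g_def jd_ginv_def jd_x_def jd_y_def)
  qed (simp_all add: assms(9,10) plus_jordan_double.abs_eq[symmetric]
      times_jordan_double.abs_eq[symmetric])
qed

lemma weyl_induct [case_names scalar q1 q2 p1 p2 add mult]:
  fixes P :: "'r::comm_ring_1 weyl2 \<Rightarrow> bool"
  assumes "\<And>c. P (weyl_scalar c)" "P weyl_q1" "P weyl_q2" "P weyl_p1" "P weyl_p2"
    and "\<And>a b. P a \<Longrightarrow> P b \<Longrightarrow> P (a + b)" "\<And>a b. P a \<Longrightarrow> P b \<Longrightarrow> P (a * b)"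
  shows "P a"
proof (induct a rule: weyl2.abs_induct)
  fix F :: "(weyl_gen, 'r) free_algebra"
  show "P (abs_weyl2 F)"
  proof (induction F rule: free_algebra_induct)
    case (scalar c)
    then show ?case using assms(1) by (simp add: weyl_scalar.abs_eq)
  next
    case (gen g)
    then show ?case using assms(2-5)
      by (cases g) (simp_all add: weyl_q1_def weyl_q2_def weyl_p1_def weyl_p2_def)
  qed (simp_all add: assms(6,7) plus_weyl2.abs_eq[symmetric] times_weyl2.abs_eq[symmetric])
qed

text \<open>The universal property of the presentation. A class is sent to the value of a
  representative; the choice does not matter, since the defining relations evaluate to zero and
  hence so does the ideal they generate.\<close>

lemma jd_hom_exists:
  fixes \<rho> :: "'k::field \<Rightarrow> 'a::ring_1"
  assumes \<rho>: "is_ring_hom \<rho>" and comm: "\<And>c a. \<rho> c * a = a * \<rho> c"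
    and rel: "g * g' = 1" "g' * g = 1" "\<zeta> * g = g * \<zeta>" "g * x = x * g" "g * y = y * g + x * g"
      "\<zeta> * y = y * \<zeta> + y" "\<zeta> * x = x * \<zeta> + x" "u * g = g * u" "v * g = g * v + g * u"
      "v * \<zeta> = \<zeta> * v + v" "u * \<zeta> = \<zeta> * u + u" "y * x = x * y - \<rho> (1/2) * x^2"
      "v * u = u * v - \<rho> (1/2) * u^2" "u * x = x * u" "v * x = x * v + (1 - g) + x * u"
      "u * y = y * u + (1 - g)" "v * y = y * v - g * \<zeta> + y * u"
  obtains f where "is_ring_hom f" "\<And>c. f (jd_scalar c) = \<rho> c" "f jd_u = u" "f jd_v = v"
    "f jd_zeta = \<zeta>" "f jd_g = g" "f jd_ginv = g'" "f jd_x = x" "f jd_y = y"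
proof -
  define e where "e = case_jd_gen u v \<zeta> g g' x y"
  have [simp]: "e U_gen = u" "e V_gen = v" "e Zeta_gen = \<zeta>" "e G_gen = g" "e Ginv_gen = g'"
    "e X_gen = x" "e Y_gen = y" by (simp_all add: e_def)
  define E where "E = free_eval \<rho> e"
  define f where "f a = E (rep_jordan_double a)" for a
  have cong: "E F = E G" if "ideal_cong jd_relations F G" for F G
    unfolding E_def
  proof (rule free_eval_ideal_cong[OF \<rho> comm _ that])
    fix r :: "(jd_gen, 'k) free_algebra"
    assume "r \<in> jd_relations"
    then show "free_eval \<rho> e r = 0"
      by (auto simp: jd_relations_def Let_def ring_hom_simps[OF free_eval_hom[where e = e, OF \<rho> comm]]
          free_eval_gen[where e = e, OF \<rho> comm] free_eval_scalar[where e = e, OF \<rho> comm] rel)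
  qed
  have f_abs: "f (abs_jordan_double F) = E F" for F
    unfolding f_def by (rule cong)
      (metis Quotient3_abs_rep Quotient3_jordan_double jordan_double.abs_eq_iff)
  note h = ring_hom_simps[OF free_eval_hom[where e = e, OF \<rho> comm], folded E_def]
  have "is_ring_hom f"
  proof -
    have "f (a + b) = f a + f b \<and> f (a * b) = f a * f b" for a b
    proof (induct a rule: jordan_double.abs_induct, induct b rule: jordan_double.abs_induct)
      fix F G
      show "f (abs_jordan_double F + abs_jordan_double G)
          = f (abs_jordan_double F) + f (abs_jordan_double G)
        \<and> f (abs_jordan_double F * abs_jordan_double G)
          = f (abs_jordan_double F) * f (abs_jordan_double G)"
        by (simp only: plus_jordan_double.abs_eq times_jordan_double.abs_eq f_abs h simp_thms)
    qed
    moreover have "f 1 = 1" by (simp add: one_jordan_double_def f_abs h)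
    ultimately show ?thesis by (simp add: is_ring_hom_def)
  qed
  then show ?thesis
    by (rule that)
       (simp_all add: jd_scalar.abs_eq jd_u_def jd_v_def jd_zeta_def jd_g_def jd_ginv_def jd_x_def
         jd_y_def f_abs E_def free_eval_gen[where e = e, OF \<rho> comm]
         free_eval_scalar[where e = e, OF \<rho> comm])
qed

text \<open>The scalars are required to commute only with the images of the four generators. This is
  what can be checked directly in the localized double; there, full centrality is a consequence of
  the isomorphism.\<close>

lemma weyl_hom_exists:
  fixes \<rho> :: "'r::comm_ring_1 \<Rightarrow> 'a::ring_1"
  assumes \<rho>: "is_ring_hom \<rho>"
    and comm: "\<And>c a. a \<in> {q1, q2, p1, p2} \<Longrightarrow> \<rho> c * a = a * \<rho> c"
    and rel: "p1 * q1 = q1 * p1 + 1" "p2 * q2 = q2 * p2 + 1" "p1 * q2 = q2 * p1"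
      "p2 * q1 = q1 * p2" "q1 * q2 = q2 * q1" "p1 * p2 = p2 * p1"
  obtains f where "is_ring_hom f" "\<And>c. f (weyl_scalar c) = \<rho> c" "f weyl_q1 = q1"
    "f weyl_q2 = q2" "f weyl_p1 = p1" "f weyl_p2 = p2"
proof -
  define e where "e = case_weyl_gen q1 q2 p1 p2"
  have [simp]: "e Q1_gen = q1" "e Q2_gen = q2" "e P1_gen = p1" "e P2_gen = p2"
    by (simp_all add: e_def)
  have comm': "\<rho> c * e i = e i * \<rho> c" for c i
    by (cases i) (simp_all add: comm)
  define E where "E = free_eval \<rho> e"
  define f where "f a = E (rep_weyl2 a)" for a
  have cong: "E F = E G" if "ideal_cong weyl_relations F G" for F G
    unfolding E_def
  proof (rule free_eval_ideal_cong[OF \<rho> comm' _ that])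
    fix r :: "(weyl_gen, 'r) free_algebra"
    assume "r \<in> weyl_relations"
    then show "free_eval \<rho> e r = 0"
      by (auto simp: weyl_relations_def Let_def ring_hom_simps[OF free_eval_hom[where e = e, OF \<rho> comm']]
          free_eval_gen[where e = e, OF \<rho> comm'] rel)
  qed
  have f_abs: "f (abs_weyl2 F) = E F" for F
    unfolding f_def by (rule cong)
      (metis Quotient3_abs_rep Quotient3_weyl2 weyl2.abs_eq_iff)
  note h = ring_hom_simps[OF free_eval_hom[where e = e, OF \<rho> comm'], folded E_def]
  have "is_ring_hom f"
  proof -
    have "f (a + b) = f a + f b \<and> f (a * b) = f a * f b" for a b
    proof (induct a rule: weyl2.abs_induct, induct b rule: weyl2.abs_induct)
      fix F G
      show "f (abs_weyl2 F + abs_weyl2 G) = f (abs_weyl2 F) + f (abs_weyl2 G)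
        \<and> f (abs_weyl2 F * abs_weyl2 G) = f (abs_weyl2 F) * f (abs_weyl2 G)"
        by (simp only: plus_weyl2.abs_eq times_weyl2.abs_eq f_abs h simp_thms)
    qed
    moreover have "f 1 = 1" by (simp add: one_weyl2_def f_abs h)
    ultimately show ?thesis by (simp add: is_ring_hom_def)
  qed
  then show ?thesis
    by (rule that)
       (simp_all add: weyl_scalar.abs_eq weyl_q1_def weyl_q2_def weyl_p1_def weyl_p2_def f_abs E_def
         free_eval_gen[where e = e, OF \<rho> comm'] free_eval_scalar[where e = e, OF \<rho> comm'])
qed

lemma jd_relations_hold:
  fixes h :: "'k::field jordan_double"
  defines "h \<equiv> jd_scalar (1/2)"
  shows "jd_g * jd_ginv = (1 :: 'k jordan_double)" "jd_ginv * jd_g = (1 :: 'k jordan_double)"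
    "jd_zeta * jd_g = jd_g * (jd_zeta :: 'k jordan_double)"
    "jd_g * jd_x = jd_x * (jd_g :: 'k jordan_double)"
    "jd_g * jd_y = jd_y * jd_g + jd_x * (jd_g :: 'k jordan_double)"
    "jd_zeta * jd_y = jd_y * jd_zeta + (jd_y :: 'k jordan_double)"
    "jd_zeta * jd_x = jd_x * jd_zeta + (jd_x :: 'k jordan_double)"
    "jd_u * jd_g = jd_g * (jd_u :: 'k jordan_double)"
    "jd_v * jd_g = jd_g * jd_v + jd_g * (jd_u :: 'k jordan_double)"
    "jd_v * jd_zeta = jd_zeta * jd_v + (jd_v :: 'k jordan_double)"
    "jd_u * jd_zeta = jd_zeta * jd_u + (jd_u :: 'k jordan_double)"
    "jd_y * jd_x = jd_x * jd_y - h * jd_x^2"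
    "jd_v * jd_u = jd_u * jd_v - h * jd_u^2"
    "jd_u * jd_x = jd_x * (jd_u :: 'k jordan_double)"
    "jd_v * jd_x = jd_x * jd_v + (1 - jd_g) + jd_x * (jd_u :: 'k jordan_double)"
    "jd_u * jd_y = jd_y * jd_u + (1 - (jd_g :: 'k jordan_double))"
    "jd_v * jd_y = jd_y * jd_v - jd_g * jd_zeta + jd_y * (jd_u :: 'k jordan_double)"
  unfolding h_def power2_eq_square
  by (transfer, unfold ideal_cong_def, rule two_sided_ideal_base,
      simp add: jd_relations_def Let_def power2_eq_square)+

lemma weyl_relations_hold:
  "weyl_p1 * weyl_q1 = weyl_q1 * weyl_p1 + (1 :: 'r::comm_ring_1 weyl2)"
  "weyl_p2 * weyl_q2 = weyl_q2 * weyl_p2 + (1 :: 'r weyl2)"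
  "weyl_p1 * weyl_q2 = weyl_q2 * (weyl_p1 :: 'r weyl2)"
  "weyl_p2 * weyl_q1 = weyl_q1 * (weyl_p2 :: 'r weyl2)"
  "weyl_q1 * weyl_q2 = weyl_q2 * (weyl_q1 :: 'r weyl2)"
  "weyl_p1 * weyl_p2 = weyl_p2 * (weyl_p1 :: 'r weyl2)"
  by (transfer, unfold ideal_cong_def, rule two_sided_ideal_base,
      simp add: weyl_relations_def Let_def algebra_simps)+

section \<open>The double inside a localized Weyl algebra\<close>

text \<open>\<open>Z\<close>, \<open>Z'\<close> and \<open>t\<close> stand for z, its inverse and z'
  respectively: the prime on \<open>Z'\<close> denotes an inverse, as it does in \<open>q1'\<close>
  and \<open>q2'\<close>.\<close>

locale localized_weyl =
  fixes Z Z' t q1 q1' q2 q2' p1 p2 :: "'a::ring_1"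
  assumes Z: "\<And>a. a * Z = Z * a" and Z': "\<And>a. a * Z' = Z' * a" and t: "\<And>a. a * t = t * a"
    and ZZ': "Z * Z' = 1"
    and q1: "q1 * q1' = 1" "q1' * q1 = 1" and q2: "q2 * q2' = 1" "q2' * q2 = 1"
    and q2q1: "q2 * q1 = q1 * q2" and p1q1: "p1 * q1 = q1 * p1 + 1" and p1q2: "p1 * q2 = q2 * p1"
    and p2q2: "p2 * q2 = q2 * p2 + 1" and p2q1: "p2 * q1 = q1 * p2" and p2p1: "p2 * p1 = p1 * p2"
begin

text \<open>The last rule is the derivative of the inverse of \<open>q1\<close>, found by
  multiplying \<open>p1 * q1 = q1 * p1 + 1\<close> by \<open>q1'\<close> on both sides.\<close>

lemma q1'_rules: "q2 * q1' = q1' * q2" "p2 * q1' = q1' * p2" "p1 * q1' = q1' * p1 - q1' * q1'"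
proof -
  show "q2 * q1' = q1' * q2" "p2 * q1' = q1' * p2"
    using commutes_inverse[OF q1] q2q1 p2q1 by blast+
  have "q1' * (p1 * q1) * q1' = q1' * (q1 * p1 + 1) * q1'" by (simp add: p1q1)
  moreover have "q1' * (p1 * q1) * q1' = q1' * p1" using q1 by (simp add: mult.assoc)
  moreover have "q1' * (q1 * p1 + 1) * q1' = p1 * q1' + q1' * q1'"
    using q1 by (simp add: distrib_left distrib_right mult.assoc[symmetric])
  ultimately show "p1 * q1' = q1' * p1 - q1' * q1'" by simp
qed

lemmas central = Z'[of t] Z'[of q1] Z'[of q1'] Z'[of q2] Z'[of p1] Z'[of p2]
  t[of q1] t[of q1'] t[of q2] t[of p1] t[of p2]

text \<open>All rules are oriented towards the order \<open>Z'\<close>, \<open>t\<close>, powers of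
  \<open>q1\<close> and \<open>q1'\<close>, \<open>q2\<close>, \<open>p1\<close>, \<open>p2\<close>.
  An identity in these letters is then proved by rewriting both sides to normal form.\<close>

lemmas order_rules = q1 q2q1 p1q1 p1q2 p2q2 p2q1 p2p1 q1'_rules central

lemmas normal_form = order_rules order_rules[THEN mult_assoc_rule] mult.assoc
  distrib_left distrib_right left_diff_distrib right_diff_distrib

definition "g = Z' * (q2 * q2)"
definition "u = q1' * (q2 - g - g - 1 - 1)"
definition "\<zeta> = q1 * p1"

text \<open>These are \<open>2y\<close> and \<open>2v\<close>, so that the coefficients are integers.\<close>

definition "Y = - (q1 * q2 * p2) - q1 * q1 * p1"
definition "V = q1' * (q2 * t + q2 * t + (q2 - 1 - 1 - g - g) * q2 * p2
  + (q2 + q2 - 1 - 1 - g - g - g - g - g - g) * q1 * p1 + 1 + 1 + 1 + 1 + g + g + g + g)"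

lemmas gens = g_def u_def \<zeta>_def Y_def V_def

text \<open>The relations of the double, with a factor 2 for each of y and v that a relation
  concerns. This removes the coefficient 1/2, and both sides reduce to the same normal form with
  integer coefficients.\<close>

lemma integral_relations:
  "\<zeta> * g = g * \<zeta>" "g * q1 = q1 * g" "g * Y = Y * g + (q1 * g + q1 * g)"
  "\<zeta> * Y = Y * \<zeta> + Y" "\<zeta> * q1 = q1 * \<zeta> + q1" "u * g = g * u"
  "V * g = g * V + (g * u + g * u)" "V * \<zeta> = \<zeta> * V + V" "u * \<zeta> = \<zeta> * u + u"
  "Y * q1 = q1 * Y - q1 * q1" "V * u = u * V - u * u" "u * q1 = q1 * u"
  "V * q1 = q1 * V + (((1 - g) + q1 * u) + ((1 - g) + q1 * u))"
  "u * Y = Y * u + ((1 - g) + (1 - g))"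
  "V * Y = Y * V + (Y * u + Y * u) - (g * \<zeta> + g * \<zeta> + (g * \<zeta> + g * \<zeta>))"
  by (simp_all add: gens normal_form)

lemma q2_eq: "u * q1 + (1 + g) + (1 + g) = q2"
  by (simp add: gens normal_form)

lemma Y_eq: "Y + q1 * \<zeta> = - (q1 * (q2 * p2))"
  by (simp add: gens normal_form)

text \<open>The definition of z', multiplied by q and doubled. The formula for \<open>V\<close> is
  the solution of this equation, written out in the Weyl generators.\<close>

lemma twice_N_eq: "q1 * V + u * Y + (- (u * q1) + g + g - 1 - 1) * \<zeta>
    - (1 + g) - (1 + g) - (1 + g) - (1 + g) = q2 * t + q2 * t"
  by (simp add: gens normal_form)

definition "g' = Z * (q2' * q2')"

lemma Z_left: "a * (Z * b) = Z * (a * b)"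
  by (simp only: mult.assoc[symmetric] Z)

lemma Z'_left: "a * (Z' * b) = Z' * (a * b)"
  by (simp only: mult.assoc[symmetric] Z')

lemma g_inverse: "g * g' = 1" "g' * g = 1"
proof -
  have "Z' * Z = 1" using Z[of Z'] ZZ' by simp
  then show "g' * g = 1"
    by (simp add: g_def g'_def mult.assoc Z'_left q2 q2[THEN mult_assoc_rule])
  show "g * g' = 1"
    by (simp add: g_def g'_def mult.assoc Z_left q2 q2[THEN mult_assoc_rule] ZZ')
qed

text \<open>Together with \<open>p1_eq\<close>, \<open>p2_eq\<close> and \<open>N_eq\<close> this
  shows that the expressions for z, p1, p2 and z' in the generators of the double return the Weyl
  data they came from. It is the computation behind \<Phi> composed with \<Psi> being the
  identity.\<close>

lemma z_eq: "q2 * q2 * g' = Z"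
  by (simp add: g'_def mult.assoc Z_left q2 q2[THEN mult_assoc_rule])

lemma p1_eq: "q1' * \<zeta> = p1"
  by (simp add: \<zeta>_def q1 mult.assoc[symmetric])

lemma p2_eq: "- (q1' * (q2' * (Y + q1 * \<zeta>))) = p2"
proof -
  have "q1' * (q2' * (q1 * (q2 * p2))) = q1' * (q2' * (q2 * q1)) * p2"
    by (simp only: q2q1 mult.assoc)
  also have "\<dots> = q1' * ((q2' * q2) * q1) * p2" by (simp only: mult.assoc)
  also have "\<dots> = p2" by (simp add: q1 q2)
  finally show ?thesis by (simp add: Y_eq)
qed

context
  fixes h :: 'a
  assumes h: "\<And>a. a * h = h * a" and hh: "h + h = 1"
begin

lemmas h_left = h[of g] h[of u] h[of \<zeta>] h[of Y] h[of V] h[of q1]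
  h[of g, THEN mult_assoc_rule] h[of u, THEN mult_assoc_rule] h[of \<zeta>, THEN mult_assoc_rule]
  h[of Y, THEN mult_assoc_rule] h[of V, THEN mult_assoc_rule] h[of q1, THEN mult_assoc_rule]

lemma half_twice: "h * a + h * a = a"
  using hh by (simp add: distrib_right[symmetric])

lemma half_twice': "h * (a + a) = a" "h * (h * (a + a + (a + a))) = a" "h * (h * (a + a)) = h * a"
proof -
  show 1: "h * (a + a) = a" for a by (simp add: distrib_left half_twice)
  then show "h * (h * (a + a + (a + a))) = a" "h * (h * (a + a)) = h * a"
    by (simp_all only: 1)
qed

text \<open>Each relation comes from its integral counterpart: the central element \<open>h\<close>
  is pulled to the front and cancelled against doubled terms, twice where both \<open>Y\<close> and
  \<open>V\<close> occur.\<close>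

lemma relations:
  "g * (h * Y) = h * Y * g + q1 * g" "\<zeta> * (h * Y) = h * Y * \<zeta> + h * Y"
  "h * V * g = g * (h * V) + g * u" "h * V * \<zeta> = \<zeta> * (h * V) + h * V"
  "h * Y * q1 = q1 * (h * Y) - h * q1^2" "h * V * u = u * (h * V) - h * u^2"
  "h * V * q1 = q1 * (h * V) + (1 - g) + q1 * u" "u * (h * Y) = h * Y * u + (1 - g)"
  "h * V * (h * Y) = h * Y * (h * V) - g * \<zeta> + h * Y * u"
  by (simp_all only: h_left mult.assoc integral_relations distrib_left[of h] right_diff_distrib[of h]
      half_twice half_twice' power2_eq_square)
     (simp_all add: distrib_left right_diff_distrib half_twice' algebra_simps half_twice hh)

lemma N_eq: "q1 * (h * V) + u * (h * Y) + (- (h * u * q1) + g - 1) * \<zeta> - (1 + g) - (1 + g) = q2 * t"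
proof -
  have "h * (q1 * V + u * Y + (- (u * q1) + g + g - 1 - 1) * \<zeta>
      - (1 + g) - (1 + g) - (1 + g) - (1 + g)) = h * (q2 * t + q2 * t)"
    by (simp only: twice_N_eq)
  moreover have "h * (q1 * V + u * Y + (- (u * q1) + g + g - 1 - 1) * \<zeta>
      - (1 + g) - (1 + g) - (1 + g) - (1 + g)) = q1 * (h * V) + u * (h * Y)
      + (- (h * u * q1) + h * (g + g) - h * (1 + 1)) * \<zeta>
      - h * ((1 + g) + (1 + g)) - h * ((1 + g) + (1 + g))"
    by (simp only: distrib_left distrib_right right_diff_distrib left_diff_distrib h_left mult.assoc
        mult_minus_left mult_minus_right) (simp add: algebra_simps)
  ultimately show ?thesis by (simp only: half_twice')
qed

end

end

section \<open>The Weyl generators inside the localized double\<close>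

locale localized_double =
  fixes h u v \<zeta> g g' x x' y q q' :: "'a::ring_1"
  assumes hh: "h + h = 1"
    and gg': "g * g' = 1" "g' * g = 1" and xx': "x * x' = 1" "x' * x = 1"
    and qq': "q * q' = 1" "q' * q = 1" and q: "q = u * x + (1 + g) + (1 + g)"
    and rel: "\<zeta> * g = g * \<zeta>" "g * x = x * g" "g * y = y * g + x * g"
      "\<zeta> * y = y * \<zeta> + y" "\<zeta> * x = x * \<zeta> + x" "u * g = g * u" "v * g = g * v + g * u"
      "v * \<zeta> = \<zeta> * v + v" "u * \<zeta> = \<zeta> * u + u" "y * x = x * y - h * (x * x)"
      "v * u = u * v - h * (u * u)" "u * x = x * u" "v * x = x * v + (1 - g) + x * u"
      "u * y = y * u + (1 - g)" "v * y = y * v - g * \<zeta> + y * u"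
begin

lemma h_half: "h * a + h * a = a"
  using hh by (simp add: distrib_right[symmetric])

text \<open>Allows an identity to be checked after doubling, where \<open>h\<close> has
  disappeared.\<close>

lemma twice_cancel: "a + a = b + b \<Longrightarrow> a = (b :: 'a)"
  using h_half by (metis distrib_left)

text \<open>Doubled as in the locale \<^locale>\<open>localized_weyl\<close>.\<close>

definition "Y = y + y"
definition "V = v + v"

lemma scaled: "Y * x = x * Y - x * x" "g * Y = Y * g + x * g + x * g" "\<zeta> * Y = Y * \<zeta> + Y"
  "u * Y = Y * u + (1 - g) + (1 - g)" "V * g = g * V + g * u + g * u" "V * \<zeta> = \<zeta> * V + V"
  "V * u = u * V - u * u" "V * x = x * V + (1 - g) + (1 - g) + x * u + x * u"
  "V * Y = Y * V - g * \<zeta> - g * \<zeta> - g * \<zeta> - g * \<zeta> + Y * u + Y * u"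
  using h_half[of "x * x"] h_half[of "u * u"]
  by (simp_all add: Y_def V_def distrib_left distrib_right rel algebra_simps)

text \<open>Oriented towards the PBW order x, y, g, \<zeta>, u, v, with \<open>Y\<close> and
  \<open>V\<close> in the places of y and v.\<close>

lemmas normal_form = rel(1,2,5,6,9,12) scaled
  rel(1,2,5,6,9,12)[THEN mult_assoc_rule] scaled[THEN mult_assoc_rule] mult.assoc
  distrib_left distrib_right left_diff_distrib right_diff_distrib

text \<open>The numerator of z'.\<close>

definition "N = x * v + u * y + (- (h * u * x) + g - 1) * \<zeta> - (1 + g) - (1 + g)"

lemma N_twice: "N + N = x * V + u * Y + (- (u * x) + g + g - 1 - 1) * \<zeta>
    - (1 + g) - (1 + g) - (1 + g) - (1 + g)"
proof -
  have "h * u * x + h * u * x = u * x" using h_half[of "u * x"] by (simp add: mult.assoc)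
  then have "- (h * u * x * \<zeta>) - h * u * x * \<zeta> = - (u * x * \<zeta>)"
    by (metis distrib_right minus_add_distrib add_uminus_conv_diff)
  then show ?thesis
    by (simp add: N_def Y_def V_def algebra_simps)
qed

lemma q_comm: "q * x = x * q" "q * \<zeta> = \<zeta> * q" "q * g = g * q" "Y * q = q * Y - x * q"
  by (simp_all add: q normal_form)

lemma N_x: "N * x = x * N"
proof (rule twice_cancel)
  have "(N + N) * x = x * (N + N)"
    unfolding N_twice by (simp add: normal_form)
  then show "N * x + N * x = x * N + x * N" by (simp add: distrib_left distrib_right)
qed

lemma N_\<zeta>: "N * \<zeta> = \<zeta> * N"
proof (rule twice_cancel)
  have "(N + N) * \<zeta> = \<zeta> * (N + N)"
    unfolding N_twice by (simp add: normal_form)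
  then show "N * \<zeta> + N * \<zeta> = \<zeta> * N + \<zeta> * N" by (simp add: distrib_left distrib_right)
qed

lemma N_g: "N * g = g * N"
proof (rule twice_cancel)
  have "(N + N) * g = g * (N + N)"
    unfolding N_twice by (simp add: normal_form)
  then show "N * g + N * g = g * N + g * N" by (simp add: distrib_left distrib_right)
qed

lemma N_q: "N * q = q * N"
proof (rule twice_cancel)
  have "(N + N) * q = q * (N + N)"
    unfolding N_twice q by (simp add: normal_form)
  then show "N * q + N * q = q * N + q * N" by (simp add: distrib_left distrib_right)
qed

text \<open>The same rule holds for \<open>q\<close> in place of \<open>N\<close>, by
  \<open>q_comm\<close>. This agreement is why the quotient z' of \<open>N\<close> by
  \<open>q\<close> commutes with \<open>Y\<close>.\<close>

lemma N_Y: "N * Y = Y * N + x * N"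
proof (rule twice_cancel)
  have "(N + N) * Y = Y * (N + N) + x * (N + N)"
    unfolding N_twice by (simp add: normal_form)
  then show "N * Y + N * Y = (Y * N + x * N) + (Y * N + x * N)"
    by (simp add: distrib_left distrib_right algebra_simps)
qed

definition "p1 = x' * \<zeta>"
definition "p2 = - (x' * (q' * (Y + x * \<zeta>)))"
definition "z = q * q * g'"
definition "z' = q' * N"

lemma p1_x: "p1 * x = x * p1 + 1"
proof -
  have "p1 * x = x' * x * \<zeta> + x' * x"
    by (simp add: p1_def mult.assoc rel distrib_left)
  also have "\<dots> = x * x' * \<zeta> + 1" by (simp add: xx')
  finally show ?thesis by (simp add: p1_def mult.assoc)
qed

lemma x'_q: "x' * q = q * x'" by (rule commutes_inverse[OF xx', symmetric]) (rule q_comm)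
lemma x'_q': "x' * q' = q' * x'" by (rule commutes_inverse[OF qq']) (rule x'_q)
lemma x_q': "x * q' = q' * x" by (rule commutes_inverse[OF qq']) (simp add: q_comm)
lemma \<zeta>_q': "\<zeta> * q' = q' * \<zeta>" by (rule commutes_inverse[OF qq']) (simp add: q_comm)

lemma p1_q: "p1 * q = q * p1"
  by (metis p1_def mult.assoc q_comm(2) x'_q)

lemma p2_q: "p2 * q = q * p2 + 1"
proof -
  \<comment> \<open>As \<zeta> commutes with \<open>q\<close>, the commutator of
    \<open>Y + x * \<zeta>\<close> with \<open>q\<close> is that of \<open>Y\<close>, namely
    \<open>- (x * q)\<close>. The prefactor in \<open>p2\<close> turns it into 1.\<close>
  have "(Y + x * \<zeta>) * q = q * (Y + x * \<zeta>) - x * q"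
    by (simp add: distrib_left distrib_right mult.assoc q_comm(2)[symmetric] q_comm(4))
       (simp add: mult.assoc[symmetric] q_comm(1))
  then have "p2 * q = - (x' * (q' * (q * (Y + x * \<zeta>)))) + x' * (q' * (x * q))"
    by (simp add: p2_def mult.assoc right_diff_distrib)
  also have "x' * (q' * (x * q)) = 1"
    by (metis mult.assoc mult_1_right qq' q_comm(1) xx')
  also have "x' * (q' * (q * (Y + x * \<zeta>))) = q * (x' * (q' * (Y + x * \<zeta>)))"
    by (metis mult.assoc qq' x'_q x'_q')
  finally show ?thesis by (simp add: p2_def)
qed

text \<open>The summand \<open>x * \<zeta>\<close> in \<open>p2\<close> serves this purpose: its
  commutator with \<open>x\<close> is \<open>x * x\<close>, which cancels the commutator
  \<open>- (x * x)\<close> of \<open>Y\<close> with \<open>x\<close>.\<close>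

lemma p2_x: "p2 * x = x * p2"
proof -
  have "(Y + x * \<zeta>) * x = x * (Y + x * \<zeta>)"
    by (simp add: normal_form)
  then have "p2 * x = - (x' * (q' * (x * (Y + x * \<zeta>))))"
    by (simp add: p2_def mult.assoc)
  also have "x' * (q' * (x * (Y + x * \<zeta>))) = x * (x' * (q' * (Y + x * \<zeta>)))"
    by (metis mult.assoc xx' x_q' x'_q' mult_1_left)
  finally show ?thesis by (simp add: p2_def)
qed

text \<open>For the grading given by the commutator with \<zeta>, \<open>Y + x * \<zeta>\<close> has
  degree 1, \<open>x'\<close> has degree -1 and \<open>q'\<close> has degree 0, so \<open>p2\<close>
  has degree 0.\<close>

lemma \<zeta>_p2: "\<zeta> * p2 = p2 * \<zeta>"
proof -
  have "x * (\<zeta> * x') = \<zeta> - x * x'"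
  proof -
    have "x * \<zeta> * x' = (\<zeta> * x - x) * x'" by (simp add: rel)
    then show ?thesis by (simp add: mult.assoc left_diff_distrib xx')
  qed
  then have 1: "\<zeta> * x' = x' * \<zeta> - x'"
    by (metis mult.assoc mult_1_left mult_1_right right_diff_distrib xx')
  have 2: "\<zeta> * (Y + x * \<zeta>) = (Y + x * \<zeta>) * \<zeta> + (Y + x * \<zeta>)"
    by (simp add: normal_form algebra_simps)
  define w where "w = Y + x * \<zeta>"
  have "\<zeta> * (x' * (q' * w)) = (\<zeta> * x') * (q' * w)"
    by (simp only: mult.assoc)
  also have "\<dots> = x' * ((\<zeta> * q') * w) - x' * (q' * w)"
    unfolding 1 by (simp only: left_diff_distrib mult.assoc)
  also have "\<dots> = x' * (q' * (\<zeta> * w)) - x' * (q' * w)"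
    by (simp only: \<zeta>_q' mult.assoc)
  also have "\<dots> = x' * (q' * w) * \<zeta>"
    using 2 by (simp add: w_def[symmetric] distrib_left mult.assoc)
  finally show ?thesis by (simp add: p2_def w_def)
qed

lemma x'_p2: "p2 * x' = x' * p2"
  by (rule commutes_inverse[OF xx']) (rule p2_x)

lemma p1_p2: "p1 * p2 = p2 * p1"
  by (metis p1_def mult.assoc \<zeta>_p2 x'_p2)

lemma g'_comm: "x * g' = g' * x" "\<zeta> * g' = g' * \<zeta>" "q * g' = g' * q" "N * g' = g' * N"
  by (rule commutes_inverse[OF gg'], simp add: rel q_comm N_g)+

lemma Y_g': "Y * g' = g' * Y + g' * x + g' * x"
proof -
  have "g' * (g * Y) * g' = g' * (Y * g + x * g + x * g) * g'" by (simp add: scaled)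
  moreover have "g' * (g * Y) * g' = Y * g'" by (simp add: mult.assoc[symmetric] gg')
  moreover have "g' * (Y * g + x * g + x * g) * g' = g' * Y + g' * x + g' * x"
    by (simp add: distrib_left distrib_right mult.assoc gg')
  ultimately show ?thesis by simp
qed

lemma z_comm: "z * x = x * z" "z * q = q * z" "z * \<zeta> = \<zeta> * z" "z * Y = Y * z" "z * N = N * z"
proof -
  show "z * x = x * z" "z * q = q * z" "z * \<zeta> = \<zeta> * z" "z * N = N * z"
    unfolding z_def by (metis mult.assoc q_comm g'_comm N_q)+
  \<comment> \<open>Moving \<open>Y\<close> past the two factors \<open>q\<close> costs
    \<open>x * q * q * g'\<close> twice, and moving it past \<open>g'\<close> returns the same term
    twice.\<close>
  have "Y * z = (q * Y - x * q) * q * g'" by (simp add: z_def mult.assoc[symmetric] q_comm)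
  also have "\<dots> = q * (Y * q) * g' - x * q * q * g'" by (simp add: left_diff_distrib mult.assoc)
  also have "\<dots> = q * q * (Y * g') - q * x * q * g' - x * q * q * g'"
    by (simp add: q_comm(4) left_diff_distrib right_diff_distrib mult.assoc)
  also have "\<dots> = z * Y + q * q * (g' * x) + q * q * (g' * x) - q * x * q * g' - x * q * q * g'"
    by (simp add: Y_g' z_def distrib_left mult.assoc)
  also have "q * q * (g' * x) = x * q * q * g'"
    by (metis mult.assoc q_comm(1) g'_comm(1))
  also have "q * x * q * g' = x * q * q * g'" by (simp add: q_comm)
  finally show "z * Y = Y * z" by simp
qed

lemma z'_comm: "z' * x = x * z'" "z' * q = q * z'" "z' * \<zeta> = \<zeta> * z'" "z' * Y = Y * z'"
proof -
  show "z' * x = x * z'" "z' * q = q * z'" "z' * \<zeta> = \<zeta> * z'"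
    unfolding z'_def by (metis mult.assoc N_x x_q' N_q qq' mult_1_left mult_1_right N_\<zeta> \<zeta>_q')+
  \<comment> \<open>The bracket equals \<open>q * Y\<close>, so the outer \<open>q'\<close> on the
    left cancels.\<close>
  have "q' * (Y * q + x * q) * q' = Y * q'"
    by (simp add: q_comm mult.assoc[symmetric] qq')
  then have "Y * q' = q' * Y + q' * x"
    by (simp add: distrib_left distrib_right mult.assoc qq')
  then show "z' * Y = Y * z'"
    by (simp add: z'_def N_Y mult.assoc[symmetric])
       (simp add: mult.assoc distrib_left distrib_right N_Y)
qed

lemma z_z': "z * z' = z' * z"
  unfolding z'_def by (metis mult.assoc z_comm(2,5) commutes_inverse[OF qq'])

definition "zi = g * (q' * q')"

lemma z_inverse: "z * zi = 1" "zi * z = 1"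
proof -
  have "z * zi = q * q * (g' * g) * q' * q'" by (simp only: z_def zi_def mult.assoc)
  also have "\<dots> = q * (q * q') * q'" by (simp only: gg' mult_1_right mult.assoc)
  finally show "z * zi = 1" by (simp add: qq')
  have "zi * z = g * (q' * (q' * q) * q) * g'" by (simp only: z_def zi_def mult.assoc)
  then show "zi * z = 1" by (simp add: qq' gg')
qed

lemma z_central: "z * p1 = p1 * z" "z * p2 = p2 * z"
proof -
  have x': "z * x' = x' * z" by (rule commutes_inverse[OF xx']) (rule z_comm)
  have q': "z * q' = q' * z" by (rule commutes_inverse[OF qq']) (rule z_comm)
  show "z * p1 = p1 * z" unfolding p1_def by (metis mult.assoc x' z_comm(3))
  have "z * (Y + x * \<zeta>) = (Y + x * \<zeta>) * z"
    by (simp add: distrib_left distrib_right z_comm mult.assoc[symmetric])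
       (simp add: mult.assoc z_comm)
  then have "z * (x' * (q' * (Y + x * \<zeta>))) = x' * (q' * (Y + x * \<zeta>)) * z"
    by (metis mult.assoc x' q')
  then show "z * p2 = p2 * z" by (simp add: p2_def)
qed

lemma z'_central: "z' * p1 = p1 * z'" "z' * p2 = p2 * z'"
proof -
  have x': "z' * x' = x' * z'" by (rule commutes_inverse[OF xx']) (rule z'_comm)
  have q': "z' * q' = q' * z'" by (rule commutes_inverse[OF qq']) (rule z'_comm)
  show "z' * p1 = p1 * z'" unfolding p1_def by (metis mult.assoc x' z'_comm(3))
  have "z' * (Y + x * \<zeta>) = (Y + x * \<zeta>) * z'"
    by (simp add: distrib_left distrib_right z'_comm mult.assoc[symmetric])
       (simp add: mult.assoc z'_comm)
  then have "z' * (x' * (q' * (Y + x * \<zeta>))) = x' * (q' * (Y + x * \<zeta>)) * z'"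
    by (metis mult.assoc x' q')
  then show "z' * p2 = p2 * z'" by (simp add: p2_def)
qed

lemma zi_comm: "z * a = a * z \<Longrightarrow> zi * a = a * zi"
  using commutes_inverse[OF z_inverse, of a] by simp

text \<open>This and the following equations express the generators of the double through x, q,
  their inverses, p1, p2, z and z'; they make \<Psi> surjective.\<close>

lemma \<zeta>_eq: "\<zeta> = x * p1"
  by (simp add: p1_def mult.assoc[symmetric] xx')

lemma g_eq: "g = zi * (q * q)" "g' = z * (q' * q')"
proof -
  have "zi * (q * q) = g * (q' * (q' * q) * q)" by (simp only: zi_def mult.assoc)
  then show "g = zi * (q * q)" by (simp add: qq')
  have "q * q * g' = g' * (q * q)" by (metis mult.assoc g'_comm(3))
  then have "z * (q' * q') = g' * (q * (q * q') * q')" by (simp only: z_def mult.assoc)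
  then show "g' = z * (q' * q')" by (simp add: qq')
qed

lemma u_eq: "u = (q - (1 + g) - (1 + g)) * x'"
  by (simp add: q mult.assoc xx')

lemma y_eq: "y = h * (- (q * (x * p2)) - x * \<zeta>)"
proof -
  have "q * (x * p2) = - (q * (x * x') * (q' * (Y + x * \<zeta>)))"
    by (simp only: p2_def mult.assoc mult_minus_right)
  also have "\<dots> = - (q * q' * (Y + x * \<zeta>))" by (simp only: xx' mult_1_right mult.assoc)
  finally have "- (q * (x * p2)) - x * \<zeta> = Y" by (simp add: qq')
  then show ?thesis by (simp add: Y_def distrib_left h_half)
qed

lemma v_eq: "v = x' * (q * z' - u * y - (- (h * u * x) + g - 1) * \<zeta> + (1 + g) + (1 + g))"
proof -
  have "q * z' = N" by (simp add: z'_def mult.assoc[symmetric] qq')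
  then have "q * z' - u * y - (- (h * u * x) + g - 1) * \<zeta> + (1 + g) + (1 + g) = x * v"
    by (simp add: N_def algebra_simps)
  then show ?thesis by (simp add: mult.assoc[symmetric] xx')
qed

end

section \<open>The center of a localized Weyl algebra\<close>

text \<open>Polynomials in \<open>p\<close> with coefficients on the left. Iterated over
  \<open>q2\<close>, \<open>q1\<close>, \<open>p2\<close> and \<open>p1\<close> it contains all
  normally ordered elements of a Weyl algebra.\<close>

definition poly_span :: "'a::ring_1 set \<Rightarrow> 'a \<Rightarrow> 'a set"
  where "poly_span B p = {\<Sum>m<M. b m * p ^ m | M b. \<forall>m. b m \<in> B}"

lemma poly_span_add:
  assumes B: "0 \<in> B" "\<And>a b. a \<in> B \<Longrightarrow> b \<in> B \<Longrightarrow> a + b \<in> B"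
    and "c \<in> poly_span B p" "d \<in> poly_span B p"
  shows "c + d \<in> poly_span B p"
proof -
  obtain M b N b' where
    b: "\<forall>m. b m \<in> B" "c = (\<Sum>m<M. b m * p ^ m)" and b': "\<forall>m. b' m \<in> B" "d = (\<Sum>m<N. b' m * p ^ m)"
    using assms(3,4) unfolding poly_span_def by blast
  have pad: "(\<Sum>m<M. b m * p ^ m) = (\<Sum>m<K. (if m < M then b m else 0) * p ^ m)"
    if "M \<le> K" for M K and b :: "nat \<Rightarrow> 'a"
    using that by (intro sum.mono_neutral_cong_left) auto
  let ?K = "max M N" and ?b = "\<lambda>m. (if m < M then b m else 0) + (if m < N then b' m else 0)"
  have "c + d = (\<Sum>m<?K. ?b m * p ^ m)"
    unfolding b(2) b'(2)
    by (subst (1 2) pad[where K = ?K])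
       (simp_all only: distrib_right sum.distrib max.cobounded1 max.cobounded2)
  moreover have "\<forall>m. ?b m \<in> B" using b(1) b'(1) B by simp
  ultimately show ?thesis
    unfolding poly_span_def by (intro CollectI exI[of _ ?K] exI[of _ ?b]) simp
qed

lemma poly_span_zero: "0 \<in> B \<Longrightarrow> 0 \<in> poly_span B p"
  unfolding poly_span_def by (intro CollectI exI[of _ 0] exI[of _ "\<lambda>_. 0"]) simp

lemma poly_span_monomial:
  assumes "0 \<in> B" "b \<in> B"
  shows "b * p ^ m \<in> poly_span B p"
proof -
  have "b * p ^ m = (\<Sum>k<Suc m. (if k = m then b else 0) * p ^ k)"
    by (simp add: if_distrib[of "\<lambda>x. x * _"] cong: if_cong)
  then show ?thesis
    unfolding poly_span_def using assms
    by (intro CollectI exI[of _ "Suc m"] exI[of _ "\<lambda>k. if k = m then b else 0"]) simp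
qed

lemma poly_span_commutes:
  assumes "\<And>b. b \<in> B \<Longrightarrow> b * e = e * b" "p * e = e * (p :: 'a::ring_1)" "c \<in> poly_span B p"
  shows "c * e = e * c"
proof -
  obtain M b where b: "\<forall>m. b m \<in> B" "c = (\<Sum>m<M. b m * p ^ m)"
    using assms(3) unfolding poly_span_def by blast
  have "b m * p ^ m * e = e * (b m * p ^ m)" for m
    by (metis assms(1,2) b(1) mult.assoc power_commuting_commutes)
  then show ?thesis by (simp add: b(2) sum_distrib_left sum_distrib_right)
qed

lemma of_nat_mult_left_commute: "a * (of_nat n * b) = of_nat n * (a * (b :: 'a::ring_1))"
  by (metis mult.assoc mult_of_nat_commute)

text \<open>The commutator with \<open>q\<close> acts as differentiation by \<open>p\<close>. For
  \<open>m = 0\<close> the truncated exponent \<open>m - 1\<close> is harmless because its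
  coefficient is 0.\<close>

lemma weyl_power_commutator:
  assumes "p * q = q * p + (1 :: 'a::ring_1)"
  shows "p ^ m * q = q * p ^ m + of_nat m * p ^ (m - 1)"
proof (induction m)
  case (Suc m)
  have "p ^ Suc m * q = p * (q * p ^ m + of_nat m * p ^ (m - 1))"
    by (simp add: mult.assoc Suc)
  also have "\<dots> = (p * q) * p ^ m + of_nat m * (p * p ^ (m - 1))"
    by (simp only: distrib_left mult.assoc of_nat_mult_left_commute)
  also have "p * q = q * p + 1" by (rule assms)
  also have "of_nat m * (p * p ^ (m - 1)) = of_nat m * p ^ m"
    by (cases m) simp_all
  finally show ?case by (simp add: distrib_right mult.assoc)
qed simp

context
  assumes torsion_free: "\<forall>(n::int) a. of_int n * a = (0 :: 'a::ring_1) \<longrightarrow> n = 0 \<or> a = 0"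
begin

text \<open>Commuting with \<open>q\<close> makes the formal derivative in \<open>p\<close> zero.
  The derivative is shorter and again commutes with \<open>q\<close>, so induction on the length
  kills its nonconstant coefficients; torsion-freeness then removes the factors
  \<open>m\<close>.\<close>

lemma weyl_coefficients_vanish:
  fixes p q :: 'a
  assumes pq: "p * q = q * p + 1" and b: "\<And>m. b m * q = q * b m"
    and c: "(\<Sum>m<M. b m * p ^ m) * q = q * (\<Sum>m<M. b m * p ^ m)"
    and "0 < m" "m < M"
  shows "b m = 0"
  using b c \<open>0 < m\<close> \<open>m < M\<close>
proof (induction M arbitrary: b m)
  case (Suc M)
  define b' where "b' m = of_nat (Suc m) * b (Suc m)" for m
  have "(b k * p ^ k) * q = q * (b k * p ^ k) + of_nat k * b k * p ^ (k - 1)" for k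
  proof -
    have "(b k * p ^ k) * q = b k * (q * p ^ k + of_nat k * p ^ (k - 1))"
      by (simp only: mult.assoc weyl_power_commutator[OF pq])
    also have "\<dots> = (b k * q) * p ^ k + of_nat k * b k * p ^ (k - 1)"
      by (simp only: distrib_left mult.assoc of_nat_mult_left_commute)
    also have "b k * q = q * b k" by (rule Suc.prems(1))
    finally show ?thesis by (simp only: mult.assoc)
  qed
  then have "(\<Sum>k<Suc M. b k * p ^ k) * q
      = q * (\<Sum>k<Suc M. b k * p ^ k) + (\<Sum>k<Suc M. of_nat k * b k * p ^ (k - 1))"
    by (simp only: sum_distrib_left sum_distrib_right sum.distrib)
  then have "(\<Sum>k<Suc M. of_nat k * b k * p ^ (k - 1)) = 0"
    using Suc.prems(2) by simp
  then have zero: "(\<Sum>k<M. b' k * p ^ k) = 0"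
    unfolding sum.lessThan_Suc_shift by (simp add: b'_def)
  have "b' k * q = q * b' k" for k
    by (simp only: b'_def mult.assoc Suc.prems(1) of_nat_mult_left_commute)
  then have IH: "b' k = 0" if "0 < k" "k < M" for k
    using Suc.IH[of b' k] that zero by simp
  \<comment> \<open>With the other coefficients gone, the constant one is the whole derivative,
    which is zero.\<close>
  moreover have "b' 0 = 0" if "0 < M"
  proof -
    have "(\<Sum>k<M. b' k * p ^ k) = (\<Sum>k\<in>{0}. b' k * p ^ k)"
      using that IH by (intro sum.mono_neutral_right) auto
    then show ?thesis using zero by simp
  qed
  ultimately have "b' (m - 1) = 0" using Suc.prems(3,4) by (cases "m - 1") simp_all
  then have "of_int (int m) * b m = 0" using Suc.prems(3) by (simp add: b'_def)
  then show ?case using torsion_free Suc.prems(3) by (metis of_nat_0_less_iff less_irrefl)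
qed simp

text \<open>The zero element commutes with \<open>q\<close>, so the nonconstant coefficients vanish,
  and the constant one is then the sum itself.\<close>

lemma weyl_polynomial_zero:
  fixes p q :: 'a
  assumes pq: "p * q = q * p + 1" and b: "\<And>m. b m * q = q * b m"
    and c: "(\<Sum>m<M. b m * p ^ m) = 0" and "m < M"
  shows "b m = 0"
proof (cases "m = 0")
  case True
  have "b k = 0" if "0 < k" "k < M" for k
    using weyl_coefficients_vanish[of p q b, OF pq b _ that] c by simp
  then have "(\<Sum>k<M. b k * p ^ k) = (\<Sum>k\<in>{0}. b k * p ^ k)"
    using \<open>m < M\<close> True by (intro sum.mono_neutral_right) auto
  then show ?thesis using c True by simp
next
  case False
  then show ?thesis using weyl_coefficients_vanish[of p q b, OF pq b _ _ \<open>m < M\<close>] c by simp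
qed

text \<open>Only the constant coefficient survives; for the empty sum, \<open>M = 0\<close>, the
  element is \<open>0\<close>, which is why \<open>B\<close> must contain it.\<close>

lemma poly_span_commuting:
  fixes p q :: 'a
  assumes pq: "p * q = q * p + 1" and B: "0 \<in> B" "\<And>b. b \<in> B \<Longrightarrow> b * q = q * b"
    and c: "c \<in> poly_span B p" "c * q = q * c"
  shows "c \<in> B"
proof -
  obtain M b where b: "\<forall>m. b m \<in> B" "c = (\<Sum>m<M. b m * p ^ m)"
    using c(1) unfolding poly_span_def by blast
  have "b m = 0" if "0 < m" "m < M" for m
    using weyl_coefficients_vanish[OF pq _ _ that, of b] b B(2) c(2) by simp
  then have "(\<Sum>m<M. b m * p ^ m) = (\<Sum>m\<in>(if M = 0 then {} else {0}). b m * p ^ m)"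
    by (intro sum.mono_neutral_right) (auto simp: neq0_conv)
  then show ?thesis using b B(1) by (auto split: if_splits)
qed

text \<open>The commutator with the Euler operator \<open>q p\<close> multiplies \<open>b\<^sub>m q\<^sup>m\<close> by \<open>m\<close> and \<open>q\<^sup>N c\<close> by \<open>N\<close>,
  so only the term \<open>m = N\<close> survives.\<close>

lemma poly_span_power_quotient:
  fixes p q :: 'a
  assumes pq: "p * q = q * p + 1" and q: "invertible_elem q"
    and B: "0 \<in> B" "\<And>b. b \<in> B \<Longrightarrow> b * q = q * b" "\<And>b. b \<in> B \<Longrightarrow> b * p = p * b"
    and c: "q ^ N * c \<in> poly_span B q" "c * p = p * c" "c * q = q * c"
  shows "c \<in> B"
proof -
  obtain M b where b: "\<forall>m. b m \<in> B" "q ^ N * c = (\<Sum>m<M. b m * q ^ m)"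
    using c(1) unfolding poly_span_def by blast
  \<comment> \<open>The pair \<open>q\<close>, \<open>- p\<close> satisfies the same Weyl relation,
    so the results on polynomials in \<open>p\<close> apply to polynomials in
    \<open>q\<close>.\<close>
  have qp: "q * - p = - p * q + 1" using pq by simp
  have power: "p * q ^ m = q ^ m * p + of_nat m * q ^ (m - 1)" for m
    using weyl_power_commutator[OF qp, of m] by (simp add: algebra_simps)
  have shift: "q * (of_nat m * q ^ (m - 1)) = of_nat m * q ^ m" for m
    by (cases m) (simp_all add: of_nat_mult_left_commute del: of_nat_Suc)
  have euler: "q * (p * (q ^ m * a)) = q ^ m * (q * p * a) + of_nat m * (q ^ m * a)" for m a
  proof -
    have "q * (p * (q ^ m * a)) = q * (p * q ^ m) * a" by (simp only: mult.assoc)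
    also have "\<dots> = q * q ^ m * p * a + q * (of_nat m * q ^ (m - 1)) * a"
      by (simp only: power distrib_left distrib_right mult.assoc)
    also have "q * q ^ m = q ^ m * q" by (simp add: power_commuting_commutes)
    finally show ?thesis by (simp only: shift mult.assoc)
  qed
  have eigen: "q * p * (b m * q ^ m) = b m * q ^ m * (q * p) + of_nat m * (b m * q ^ m)" for m
  proof -
    have "b m * q ^ m = q ^ m * b m"
      using power_commuting_commutes[of q "b m" m] B(2) b(1) by simp
    moreover have "q * p * b m = b m * (q * p)"
      using B(2,3) b(1) by (metis mult.assoc)
    ultimately show ?thesis using euler[of m "b m"] by (simp add: mult.assoc)
  qed
  \<comment> \<open>Subtracting the two evaluations of the commutator with \<open>q * p\<close>
    leaves a vanishing polynomial in \<open>q\<close> with these coefficients; the weight difference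
    may be negative, hence an integer.\<close>
  define e where "e m = of_int (int m - int N) * b m" for m
  have "q * p * (q ^ N * c) = q ^ N * c * (q * p) + (\<Sum>m<M. of_nat m * (b m * q ^ m))"
    unfolding b(2) by (simp only: sum_distrib_left sum_distrib_right eigen sum.distrib)
  moreover have "q * p * (q ^ N * c) = q ^ N * c * (q * p) + of_nat N * (q ^ N * c)"
  proof -
    have "q * p * c = c * (q * p)" using c(2,3) by (metis mult.assoc)
    then show ?thesis using euler[of N c] by (simp only: mult.assoc)
  qed
  ultimately have "(\<Sum>m<M. of_nat m * (b m * q ^ m)) - of_nat N * (\<Sum>m<M. b m * q ^ m) = 0"
    unfolding b(2)[symmetric] by (metis add_left_cancel right_minus_eq)
  then have "(\<Sum>m<M. e m * q ^ m) = 0"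
    by (simp add: e_def left_diff_distrib sum_subtractf sum_distrib_left mult.assoc)
  moreover have "e m * - p = - p * e m" for m
  proof -
    have "e m * p = p * e m"
      unfolding e_def using b(1) B(3) by (metis mult.assoc mult_of_int_commute)
    then show ?thesis by simp
  qed
  ultimately have "e m = 0" if "m < M" for m
    using weyl_polynomial_zero[OF qp _ _ that] by blast
  then have b0: "b m = 0" if "m < M" "m \<noteq> N" for m
    using torsion_free that unfolding e_def by (metis eq_iff_diff_eq_0 of_nat_eq_iff)
  have "(\<Sum>m<M. b m * q ^ m) = (\<Sum>m\<in>(if N < M then {N} else {}). b m * q ^ m)"
    by (intro sum.mono_neutral_right) (auto simp: b0)
  then have "q ^ N * c = q ^ N * (if N < M then b N else 0)"
    using b B(2) power_commuting_commutes[of q "b N" N] by (auto split: if_splits)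
  moreover have "invertible_elem (q ^ N)"
    by (induction N) (simp_all add: q invertible_elem_one invertible_elem_mult)
  ultimately have "c = (if N < M then b N else 0)"
    by (simp only: invertible_elem_cancel_left)
  moreover have "(if N < M then b N else 0) \<in> B" using b(1) B(1) by simp
  ultimately show ?thesis by (simp only:)
qed

end

text \<open>The order of the factors is the one in which \<open>poly_span\<close> is iterated below:
  scalars first, then \<open>q2\<close>, \<open>q1\<close>, \<open>p2\<close> and finally
  \<open>p1\<close>.\<close>

inductive_set weyl_span :: "('r \<Rightarrow> 'a::ring_1) \<Rightarrow> 'a \<Rightarrow> 'a \<Rightarrow> 'a \<Rightarrow> 'a \<Rightarrow> 'a set"
  for \<rho> :: "'r \<Rightarrow> 'a" and q1 q2 p1 p2 :: 'a
  where
    zero: "0 \<in> weyl_span \<rho> q1 q2 p1 p2"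
  | monomial: "\<rho> r * q2 ^ j * q1 ^ i * p2 ^ n * p1 ^ m \<in> weyl_span \<rho> q1 q2 p1 p2"
  | add: "a \<in> weyl_span \<rho> q1 q2 p1 p2 \<Longrightarrow> b \<in> weyl_span \<rho> q1 q2 p1 p2 \<Longrightarrow>
      a + b \<in> weyl_span \<rho> q1 q2 p1 p2"

text \<open>The center is computed in the target of \<open>f\<close>, later the localization map
  \<open>\<kappa>\<close>, because \<open>q1\<close> and \<open>q2\<close> are invertible
  there.\<close>

locale weyl_image =
  fixes f :: "'r::comm_ring_1 weyl2 \<Rightarrow> 'a::ring_1"
  assumes f: "is_ring_hom f"
begin

abbreviation "\<rho> r \<equiv> f (weyl_scalar r)"
abbreviation "q1 \<equiv> f weyl_q1"
abbreviation "q2 \<equiv> f weyl_q2"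
abbreviation "p1 \<equiv> f weyl_p1"
abbreviation "p2 \<equiv> f weyl_p2"
abbreviation "X \<equiv> weyl_span \<rho> q1 q2 p1 p2"

lemma rel: "p1 * q1 = q1 * p1 + 1" "p2 * q2 = q2 * p2 + 1" "p1 * q2 = q2 * p1"
  "p2 * q1 = q1 * p2" "q1 * q2 = q2 * q1" "p1 * p2 = p2 * p1"
  using weyl_relations_hold[THEN arg_cong[where f = f]] by (simp_all add: ring_hom_simps[OF f])

lemma scalar_commute: "\<rho> r * f a = f a * \<rho> r"
  using weyl_scalar_commute[THEN arg_cong[where f = f]] by (simp add: ring_hom_simps[OF f])

lemma monomial_in: "\<rho> r * q2 ^ j * q1 ^ i * p2 ^ n * p1 ^ m \<in> X"
  by (rule weyl_span.monomial)

lemma weyl_span_mult_generator: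
  assumes gen: "\<And>r j i n m. a * (\<rho> r * q2 ^ j * q1 ^ i * p2 ^ n * p1 ^ m) \<in> X" and "x \<in> X"
  shows "a * x \<in> X"
  using assms(2)
  by (induction rule: weyl_span.induct) (simp_all add: weyl_span.intros gen distrib_left)

lemma weyl_span_of_nat_mult: "x \<in> X \<Longrightarrow> of_nat n * x \<in> X"
  by (induction n) (simp_all add: weyl_span.zero weyl_span.add distrib_right)

text \<open>A generator multiplied from the left is commuted to its place in a normally ordered
  monomial. The only correction terms come from moving \<open>p1\<close> past \<open>q1 ^ i\<close>
  or \<open>p2\<close> past \<open>q2 ^ j\<close>, and they are normally ordered again.\<close>

lemma weyl_span_mult: "x \<in> X \<Longrightarrow> f a * x \<in> X"
proof (induction a arbitrary: x rule: weyl_induct)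
  case (scalar c)
  have "\<rho> c * (\<rho> r * q2 ^ j * q1 ^ i * p2 ^ n * p1 ^ m) \<in> X" for r j i n m
    using monomial_in[of "c * r" j i n m]
    by (simp add: ring_hom_simps[OF weyl_scalar_hom] ring_hom_simps[OF f] mult.assoc)
  then show ?case using weyl_span_mult_generator scalar by blast
next
  case q1
  have "q1 * (\<rho> r * q2 ^ j * q1 ^ i * p2 ^ n * p1 ^ m) \<in> X" for r j i n m
  proof -
    have "q1 * (\<rho> r * q2 ^ j) = \<rho> r * q2 ^ j * q1"
      by (metis mult.assoc power_commuting_commutes rel(5) scalar_commute)
    then have "q1 * (\<rho> r * q2 ^ j * q1 ^ i * p2 ^ n * p1 ^ m)
        = \<rho> r * q2 ^ j * q1 ^ Suc i * p2 ^ n * p1 ^ m"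
      by (simp add: mult.assoc[symmetric])
    then show ?thesis by (simp only: monomial_in)
  qed
  then show ?case using weyl_span_mult_generator q1 by blast
next
  case q2
  have "q2 * (\<rho> r * q2 ^ j * q1 ^ i * p2 ^ n * p1 ^ m) \<in> X" for r j i n m
  proof -
    have "q2 * (\<rho> r * q2 ^ j * q1 ^ i * p2 ^ n * p1 ^ m)
        = \<rho> r * q2 ^ Suc j * q1 ^ i * p2 ^ n * p1 ^ m"
      by (simp add: mult.assoc[symmetric] scalar_commute)
    then show ?thesis by (simp only: monomial_in)
  qed
  then show ?case using weyl_span_mult_generator q2 by blast
next
  case p1
  have "p1 * (\<rho> r * q2 ^ j * q1 ^ i * p2 ^ n * p1 ^ m) \<in> X" for r j i n m
  proof -
    \<comment> \<open>The commutator rule for powers, applied to the pair \<open>q1\<close>,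
      \<open>- p1\<close>.\<close>
    have power: "p1 * q1 ^ i = q1 ^ i * p1 + of_nat i * q1 ^ (i - 1)"
      using weyl_power_commutator[of q1 "- p1" i] rel(1) by (simp add: algebra_simps)
    have "p1 * (\<rho> r * q2 ^ j) = \<rho> r * q2 ^ j * p1"
      by (simp only: mult.assoc[symmetric] scalar_commute[of _ weyl_p1, symmetric])
         (simp only: mult.assoc power_commuting_commutes[OF rel(3)[symmetric]])
    then have "p1 * (\<rho> r * q2 ^ j * q1 ^ i * p2 ^ n * p1 ^ m)
        = \<rho> r * q2 ^ j * (p1 * q1 ^ i) * p2 ^ n * p1 ^ m"
      by (simp add: mult.assoc[symmetric])
    also have "\<dots> = \<rho> r * q2 ^ j * q1 ^ i * (p1 * p2 ^ n) * p1 ^ m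
        + of_nat i * (\<rho> r * q2 ^ j * q1 ^ (i - 1) * p2 ^ n * p1 ^ m)"
      unfolding power by (simp only: distrib_left distrib_right mult.assoc of_nat_mult_left_commute)
    also have "p1 * p2 ^ n = p2 ^ n * p1"
      by (rule power_commuting_commutes[OF rel(6)[symmetric], symmetric])
    also have "\<rho> r * q2 ^ j * q1 ^ i * (p2 ^ n * p1) * p1 ^ m
        = \<rho> r * q2 ^ j * q1 ^ i * p2 ^ n * p1 ^ Suc m" by (simp add: mult.assoc)
    finally show ?thesis by (simp only: monomial_in weyl_span.add weyl_span_of_nat_mult)
  qed
  then show ?case using weyl_span_mult_generator p1 by blast
next
  case p2
  have "p2 * (\<rho> r * q2 ^ j * q1 ^ i * p2 ^ n * p1 ^ m) \<in> X" for r j i n m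
  proof -
    have power: "p2 * q2 ^ j = q2 ^ j * p2 + of_nat j * q2 ^ (j - 1)"
      using weyl_power_commutator[of q2 "- p2" j] rel(2) by (simp add: algebra_simps)
    have "p2 * (\<rho> r * q2 ^ j * q1 ^ i * p2 ^ n * p1 ^ m)
        = \<rho> r * (p2 * q2 ^ j) * q1 ^ i * p2 ^ n * p1 ^ m"
      by (simp add: mult.assoc[symmetric] scalar_commute)
    also have "\<dots> = \<rho> r * q2 ^ j * (p2 * q1 ^ i) * p2 ^ n * p1 ^ m
        + of_nat j * (\<rho> r * q2 ^ (j - 1) * q1 ^ i * p2 ^ n * p1 ^ m)"
      unfolding power by (simp only: distrib_left distrib_right mult.assoc of_nat_mult_left_commute)
    also have "p2 * q1 ^ i = q1 ^ i * p2"
      by (rule power_commuting_commutes[OF rel(4)[symmetric], symmetric])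
    also have "\<rho> r * q2 ^ j * (q1 ^ i * p2) * p2 ^ n * p1 ^ m
        = \<rho> r * q2 ^ j * q1 ^ i * p2 ^ Suc n * p1 ^ m" by (simp add: mult.assoc)
    finally show ?thesis by (simp only: monomial_in weyl_span.add weyl_span_of_nat_mult)
  qed
  then show ?case using weyl_span_mult_generator p2 by blast
next
  case (add a b)
  then show ?case by (simp add: ring_hom_simps[OF f] distrib_right weyl_span.add)
next
  case (mult a b)
  then show ?case by (simp add: ring_hom_simps[OF f] mult.assoc)
qed

lemma image_in_weyl_span: "f a \<in> X"
  using weyl_span_mult[OF monomial_in[of 1 0 0 0 0], of a]
  by (simp add: ring_hom_simps[OF weyl_scalar_hom] ring_hom_simps[OF f])

abbreviation "B0 \<equiv> range \<rho>"
abbreviation "B1 \<equiv> poly_span B0 q2"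
abbreviation "B2 \<equiv> poly_span B1 q1"
abbreviation "B3 \<equiv> poly_span B2 p2"

lemma zero_in: "0 \<in> B0" "0 \<in> B1" "0 \<in> B2" "0 \<in> B3"
proof -
  have "0 = \<rho> 0" by (simp add: ring_hom_simps[OF weyl_scalar_hom] ring_hom_simps[OF f])
  then show "0 \<in> B0" by blast
  then show "0 \<in> B1" "0 \<in> B2" "0 \<in> B3" by (intro poly_span_zero; assumption)+
qed

text \<open>Read from the left, a monomial adjoins one variable after another, and closure under
  addition passes from each coefficient set to the next.\<close>

lemma weyl_span_subset: "X \<subseteq> poly_span B3 p1"
proof
  fix a assume "a \<in> X"
  have add0: "c + d \<in> B0" if "c \<in> B0" "d \<in> B0" for c d
    using that
    by (auto simp: ring_hom_add[OF weyl_scalar_hom, symmetric] ring_hom_add[OF f, symmetric])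
  have add1: "c + d \<in> B1" if "c \<in> B1" "d \<in> B1" for c d
    by (rule poly_span_add[OF zero_in(1) add0 that])
  have add2: "c + d \<in> B2" if "c \<in> B2" "d \<in> B2" for c d
    by (rule poly_span_add[OF zero_in(2) add1 that])
  have add3: "c + d \<in> B3" if "c \<in> B3" "d \<in> B3" for c d
    by (rule poly_span_add[OF zero_in(3) add2 that])
  from \<open>a \<in> X\<close> show "a \<in> poly_span B3 p1"
  proof (induction rule: weyl_span.induct)
    case (add a b)
    show ?case by (rule poly_span_add[OF zero_in(4) add3 add.IH])
  qed (intro poly_span_zero poly_span_monomial zero_in rangeI)+
qed

text \<open>The variables are eliminated one at a time. Clearing denominators puts the element into
  the span of monomials; commuting with \<open>q1\<close> and \<open>q2\<close> excludes
  \<open>p1\<close> and \<open>p2\<close>. The Euler operator argument then excludes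
  \<open>q1\<close> and \<open>q2\<close> and removes the cleared powers.\<close>

lemma center_in_scalars:
  assumes torsion_free: "\<forall>(n::int) a. of_int n * a = (0 :: 'a) \<longrightarrow> n = 0 \<or> a = 0"
    and inv: "invertible_elem q1" "invertible_elem q2"
    and c: "\<And>a. c * f a = f a * c" and b: "q1 ^ i * (q2 ^ j * c) = f b"
  shows "c \<in> range \<rho>"
proof -
  have comm: "d * f e = f e * d" if "d \<in> B0" for d e
    using that scalar_commute by auto
  have comm1: "d * e = e * d" if "d \<in> B1" "e \<in> {q1, q2, p1}" for d e
  proof (rule poly_span_commutes[OF _ _ that(1)])
    show "b * e = e * b" if "b \<in> B0" for b using \<open>e \<in> _\<close> comm[OF that] by blast
    show "q2 * e = e * q2" using that(2) by (auto simp: rel(3) rel(5)[symmetric])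
  qed
  have comm2: "d * e = e * d" if "d \<in> B2" "e \<in> {q1, q2}" for d e
  proof (rule poly_span_commutes[OF _ _ that(1)])
    show "b * e = e * b" if "b \<in> B1" for b using \<open>e \<in> _\<close> comm1[OF that] by blast
    show "q1 * e = e * q1" using that(2) by (auto simp: rel(5))
  qed
  have comm3: "d * q1 = q1 * d" if "d \<in> B3" for d
    by (rule poly_span_commutes[OF _ _ that]) (auto intro: comm2 simp: rel(4))
  have mult_comm: "a * b * e = e * (a * b)" if "a * e = e * a" "b * e = e * b" for a b e :: 'a
    using that by (metis mult.assoc)
  \<comment> \<open>This element is left once \<open>q1 ^ i\<close> is divided off. It commutes with
    \<open>p1\<close> as well, as the Euler argument for \<open>q1\<close> requires;
    \<open>f b\<close> itself is only shown to commute with \<open>q1\<close> and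
    \<open>q2\<close>.\<close>
  have c1: "q2 ^ j * c * e = e * (q2 ^ j * c)" if "e \<in> {q1, q2, p1}" for e
  proof (rule mult_comm[OF power_commuting_commutes])
    show "q2 * e = e * q2" using that by (auto simp: rel(3) rel(5)[symmetric])
    show "c * e = e * c" using that by (auto simp: c)
  qed
  have b_comm: "f b * e = e * f b" if "e \<in> {q1, q2}" for e
    unfolding b[symmetric]
  proof (rule mult_comm[OF power_commuting_commutes c1])
    show "q1 * e = e * q1" using that by (auto simp: rel(5))
  qed (use that in auto)
  have "f b \<in> B3"
  proof (rule poly_span_commuting[OF torsion_free rel(1) zero_in(4)])
    show "f b \<in> poly_span B3 p1" using image_in_weyl_span weyl_span_subset by blast
  qed (simp_all add: b_comm comm3)
  have "f b \<in> B2"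
    by (rule poly_span_commuting[OF torsion_free rel(2) zero_in(3) _ \<open>f b \<in> B3\<close>])
       (blast intro: comm2 b_comm)+
  then have "q1 ^ i * (q2 ^ j * c) \<in> B2" using b by simp
  then have "q2 ^ j * c \<in> B1"
    by (rule poly_span_power_quotient[OF torsion_free rel(1) inv(1) zero_in(2), rotated 2])
       (blast intro: c1 comm1)+
  then show ?thesis
    by (rule poly_span_power_quotient[OF torsion_free rel(2) inv(2) zero_in(1), rotated 2])
       (blast intro: comm c)+
qed

end

section \<open>Scalars embed into a localized Weyl algebra\<close>

text \<open>The action on polynomials in \<open>q\<^sub>1\<close> and \<open>q\<^sub>2\<close>, given by their coefficient functions.\<close>

definition weyl_op :: "weyl_gen \<Rightarrow> (nat \<times> nat \<Rightarrow> 'r::comm_ring_1) \<Rightarrow> nat \<times> nat \<Rightarrow> 'r"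
  where "weyl_op = (\<lambda>g f (a, b). case g of
        Q1_gen \<Rightarrow> (if a = 0 then 0 else f (a - 1, b))
      | Q2_gen \<Rightarrow> (if b = 0 then 0 else f (a, b - 1))
      | P1_gen \<Rightarrow> of_nat (Suc a) * f (Suc a, b)
      | P2_gen \<Rightarrow> of_nat (Suc b) * f (a, Suc b))"

lemma weyl_op_linear: "linear_op (weyl_op g)"
  by (cases g) (auto simp: weyl_op_def linear_op_def algebra_simps)

lemma weyl_op_app: "weyl_op g f (a, b) = (case g of
        Q1_gen \<Rightarrow> (if a = 0 then 0 else f (a - 1, b))
      | Q2_gen \<Rightarrow> (if b = 0 then 0 else f (a, b - 1))
      | P1_gen \<Rightarrow> of_nat (Suc a) * f (Suc a, b)
      | P2_gen \<Rightarrow> of_nat (Suc b) * f (a, Suc b))"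
  by (simp add: weyl_op_def)

lemma weyl_op_relations: "r \<in> weyl_relations \<Longrightarrow> free_act weyl_op r f = (\<lambda>i. 0)"
  by (auto simp: weyl_relations_def Let_def free_act_add free_act_diff free_act_mult[OF weyl_op_linear]
      free_act_gen free_act_one fun_eq_iff distrib_left distrib_right ac_simps weyl_op_app
      split: if_splits)

text \<open>A denominator acts on coefficient functions as a shift, so no coefficient is
  lost.\<close>

lemma weyl_q_shift:
  assumes "s \<in> mult_set {weyl_q1, weyl_q2 :: 'r::comm_ring_1 weyl2}"
  shows "\<exists>F i j. s = abs_weyl2 F \<and> (\<forall>f a b. free_act weyl_op F f (a + i, b + j) = f (a, b))"
  using assms
proof (induction rule: mult_set.induct)
  case one
  show ?case
    by (rule exI[of _ 1], rule exI[of _ 0], rule exI[of _ 0])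
       (simp add: one_weyl2_def free_act_one)
next
  case (gen a)
  then consider "a = weyl_q1" | "a = weyl_q2" by blast
  then show ?case
  proof cases
    case 1
    then show ?thesis
      by (intro exI[of _ "free_gen Q1_gen"] exI[of _ 1] exI[of _ 0])
         (simp add: weyl_q1_def free_act_gen weyl_op_def)
  next
    case 2
    then show ?thesis
      by (intro exI[of _ "free_gen Q2_gen"] exI[of _ 0] exI[of _ 1])
         (simp add: weyl_q2_def free_act_gen weyl_op_def)
  qed
next
  case (mult s t)
  then obtain F i j G k l where
    "s = abs_weyl2 F" "\<forall>f a b. free_act weyl_op F f (a + i, b + j) = f (a, b)"
    "t = abs_weyl2 G" "\<forall>f a b. free_act weyl_op G f (a + k, b + l) = f (a, b)"
    by blast
  then have "s * t = abs_weyl2 (F * G)"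
    "free_act weyl_op (F * G) f (a + (k + i), b + (l + j)) = f (a, b)" for f a b
    by (simp_all add: times_weyl2.abs_eq free_act_mult[OF weyl_op_linear] add.assoc[symmetric])
  then show ?case by blast
qed

text \<open>Applied to the constant function 1, the product \<open>weyl_scalar r * s\<close> has
  coefficient \<open>r\<close> at the position \<open>(i, j)\<close> to which \<open>s\<close>
  shifts the origin.\<close>

lemma weyl_scalar_torsion_free:
  assumes "s \<in> mult_set {weyl_q1, weyl_q2}" "weyl_scalar r * s = 0"
  shows "r = 0"
proof -
  obtain F i j where F: "s = abs_weyl2 F"
    "\<And>f a b. free_act weyl_op F f (a + i, b + j) = f (a, b)"
    using weyl_q_shift[OF assms(1)] by blast
  have "abs_weyl2 (free_scalar r * F) = abs_weyl2 0"
    using assms(2) by (simp add: F(1) weyl_scalar.abs_eq times_weyl2.abs_eq zero_weyl2_def)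
  then have "free_scalar r * F \<in> two_sided_ideal weyl_relations"
    by (simp add: weyl2.abs_eq_iff ideal_cong_def)
  from free_act_ideal[OF weyl_op_linear weyl_op_relations this]
  have "free_act weyl_op (free_scalar r * F) (\<lambda>_. 1) = (\<lambda>i. 0)" .
  then have "r * free_act weyl_op F (\<lambda>_. 1) (0 + i, 0 + j) = 0"
    by (simp add: free_act_mult[OF weyl_op_linear] free_act_scalar fun_eq_iff)
  then show ?thesis using F(2)[of "\<lambda>_. 1" 0 0] by simp
qed

lemma weyl_q_monomial:
  assumes "s \<in> mult_set {weyl_q1, weyl_q2 :: 'r::comm_ring_1 weyl2}"
  shows "\<exists>i j. s = weyl_q1 ^ i * weyl_q2 ^ j"
  using assms
proof (induction rule: mult_set.induct)
  case one
  show ?case by (rule exI[of _ 0], rule exI[of _ 0]) simp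
next
  case (gen a)
  then consider "a = weyl_q1" | "a = weyl_q2" by blast
  then show ?case
  proof cases
    case 1
    then show ?thesis by (intro exI[of _ 1] exI[of _ 0]) simp
  next
    case 2
    then show ?thesis by (intro exI[of _ 0] exI[of _ 1]) simp
  qed
next
  case (mult s t)
  then obtain i j k l where st: "s = weyl_q1 ^ i * weyl_q2 ^ j" "t = weyl_q1 ^ k * weyl_q2 ^ l"
    by blast
  have "weyl_q2 ^ j * weyl_q1 ^ k = weyl_q1 ^ k * (weyl_q2 ^ j :: 'r weyl2)"
    by (intro power_commuting_commutes power_commuting_commutes[symmetric] weyl_relations_hold(5))
  then have "s * t = weyl_q1 ^ (i + k) * weyl_q2 ^ (j + l)"
    unfolding st by (simp add: power_add) (metis mult.assoc)
  then show ?case by blast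
qed

section \<open>Laurent polynomials\<close>

definition laurent_Zinv :: "'k::field laurent_ring"
  where "laurent_Zinv = Poly_Mapping.single (-1) 1"

lemma laurent_Z_inverse: "laurent_Z * laurent_Zinv = 1" "laurent_Zinv * laurent_Z = 1"
  by (simp_all add: laurent_Z_def laurent_Zinv_def mult_single single_one)

lemma laurent_const_hom: "is_ring_hom (laurent_const :: 'k::field \<Rightarrow> _)"
  by (simp add: is_ring_hom_def laurent_const_def single_add[symmetric] mult_single mult.commute
      flip: single_one one_pCons)

text \<open>Every element is a sum of terms p(Z') times an integer power of Z; the polynomial factor
  is handled by Horner's scheme and the power by induction in both directions.\<close>

lemma laurent_induct [case_names const Z Zinv Z' add mult]:
  fixes P :: "'k::field laurent_ring \<Rightarrow> bool"
  assumes const: "\<And>c. P (laurent_const c)" and "P laurent_Z" "P laurent_Zinv" "P laurent_Z'"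
    and add: "\<And>a b. P a \<Longrightarrow> P b \<Longrightarrow> P (a + b)" and mult: "\<And>a b. P a \<Longrightarrow> P b \<Longrightarrow> P (a * b)"
  shows "P r"
proof -
  have poly: "P (Poly_Mapping.single 0 p)" for p
  proof (induction p)
    case 0
    show ?case using const[of 0] by (simp add: laurent_const_def)
  next
    case (pCons c p)
    have "Poly_Mapping.single 0 (pCons c p)
        = laurent_const c + laurent_Z' * Poly_Mapping.single (0::int) p"
      by (simp add: laurent_const_def laurent_Z'_def mult_single single_add[symmetric])
    then show ?case using add[OF const mult[OF assms(4) pCons(2)]] by simp
  qed
  have power: "P (Poly_Mapping.single m 1)" for m
  proof (induction m rule: int_induct[where k = 0])
    case base
    show ?case using poly[of 1] by simp
  next
    case (step1 i)
    then show ?case using mult[OF assms(2) step1(2)]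
      by (simp add: laurent_Z_def mult_single add.commute)
  next
    case (step2 i)
    then show ?case using mult[OF assms(3) step2(2)]
      by (simp add: laurent_Zinv_def mult_single)
  qed
  have "P (Poly_Mapping.single m p)" for m p
    using mult[OF poly[of p] power[of m]] by (simp add: mult_single)
  moreover have "P 0" using poly[of 0] by simp
  ultimately have "P (\<Sum>m\<in>A. Poly_Mapping.single m (h m))" for A h
    by (induction A rule: infinite_finite_induct) (simp_all add: add)
  then show ?thesis by (subst poly_mapping_expand[of r])
qed

text \<open>The inner variable becomes Z', so each inner sum reassembles \<open>coeff P i\<close>;
  the outer variable becomes Z, so this coefficient lands at exponent \<open>i\<close>.\<close>

lemma eval_poly2_laurent:
  "(\<Sum>i\<le>degree P. \<Sum>j\<le>degree (coeff P i).
      laurent_const (coeff (coeff P i) j) * laurent_Z ^ i * laurent_Z' ^ j)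
    = (\<Sum>i\<le>degree P. Poly_Mapping.single (int i) (coeff P i))"
proof -
  have Z: "laurent_Z ^ i = Poly_Mapping.single (int i) (1 :: 'a poly)" for i
    by (induction i) (simp_all add: laurent_Z_def mult_single single_one)
  have Z': "laurent_Z' ^ j = Poly_Mapping.single (0::int) (monom (1 :: 'a) j)" for j
    by (induction j)
      (simp_all add: laurent_Z'_def mult_single monom_Suc monom_0 single_one flip: one_pCons)
  have single_sum: "(\<Sum>j\<in>A. Poly_Mapping.single m (h j)) = Poly_Mapping.single m (\<Sum>j\<in>A. h j)"
    for A m and h :: "nat \<Rightarrow> 'a poly"
    by (induction A rule: infinite_finite_induct) (simp_all add: single_add)
  show ?thesis
    by (simp add: Z Z' laurent_const_def mult_single single_sum smult_monom poly_as_sum_of_monoms)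
qed

lemma eval_poly2_laurent_zero:
  assumes "(\<Sum>i\<le>degree P. Poly_Mapping.single (int i) (coeff P i)) = 0"
  shows "P = 0"
proof (rule poly_eqI)
  fix n
  have "Poly_Mapping.lookup (\<Sum>i\<le>degree P. Poly_Mapping.single (int i) (coeff P i)) (int n)
      = coeff P n"
    by (simp add: lookup_sum lookup_single when_def coeff_eq_0)
  then show "coeff P n = coeff 0 n" using assms by simp
qed

section \<open>The isomorphism\<close>

text \<open>A right denominator of \<open>b\<close> and its numerator both commute with
  \<open>c\<close>, and the denominator can be cancelled.\<close>

lemma ore_central:
  assumes loc: "is_ore_localization S \<iota>" and c: "\<And>a. c * \<iota> a = \<iota> a * c"
  shows "c * b = b * c"
proof -
  obtain a s where s: "s \<in> S" "b * \<iota> s = \<iota> a" by (rule ore_right_fraction[OF loc])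
  have "c * b * \<iota> s = b * c * \<iota> s" by (metis c mult.assoc s(2))
  then show ?thesis using ore_invertible[OF loc s(1)] by (simp add: invertible_elem_cancel_right)
qed

lemma ring_hom_range:
  assumes \<Psi>: "is_ring_hom \<Psi>"
  shows "a \<in> range \<Psi> \<Longrightarrow> b \<in> range \<Psi> \<Longrightarrow> a + b \<in> range \<Psi>"
    "a \<in> range \<Psi> \<Longrightarrow> b \<in> range \<Psi> \<Longrightarrow> a * b \<in> range \<Psi>"
    "a \<in> range \<Psi> \<Longrightarrow> b \<in> range \<Psi> \<Longrightarrow> a - b \<in> range \<Psi>"
    "a \<in> range \<Psi> \<Longrightarrow> - a \<in> range \<Psi>" "1 \<in> range \<Psi>"
  by (auto simp: ring_hom_simps(2,3,5,6)[OF \<Psi>, symmetric] intro: range_eqI[of _ _ 1]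
      simp: ring_hom_one[OF \<Psi>])

lemma jd_q_eq: "jd_q = jd_u * jd_x + (1 + jd_g) + (1 + jd_g)"
  by (simp only: jd_q_def mult_2 add.assoc)

theorem theorem4p8:
  fixes \<iota> :: "'k::{alg_closed_field, field_char_0} jordan_double \<Rightarrow> 'd::ring_1"
    and \<kappa> :: "'k laurent_ring weyl2 \<Rightarrow> 'w::ring_1"
  assumes "is_ore_localization (mult_set {jd_x, jd_q}) \<iota>"
    and "is_ore_localization (mult_set {weyl_q1, weyl_q2}) \<kappa>"
  shows "algebraically_independent2 (\<iota> \<circ> jd_scalar) (\<iota> jd_z) (jd_z' \<iota>) \<and>
    (ring_center :: 'd set) =
      generated_subalgebra (\<iota> \<circ> jd_scalar) {\<iota> jd_z, ring_inv (\<iota> jd_z), jd_z' \<iota>} \<and>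
    (\<exists>\<Phi> :: 'd \<Rightarrow> 'w. is_ring_hom \<Phi> \<and> bij \<Phi> \<and>
      (\<forall>c. \<Phi> (\<iota> (jd_scalar c)) = \<kappa> (weyl_scalar (laurent_const c))) \<and>
      \<Phi> (\<iota> jd_z) = \<kappa> (weyl_scalar laurent_Z) \<and>
      \<Phi> (jd_z' \<iota>) = \<kappa> (weyl_scalar laurent_Z'))"
proof -

  \<comment> \<open>The homomorphism \<Phi> from the localized double to the localized Weyl
    algebra\<close>
  note \<iota>_hom = ore_hom[OF assms(1)] and \<kappa>_hom = ore_hom[OF assms(2)]
  note h\<iota> = ring_hom_simps[OF \<iota>_hom] and h\<kappa> = ring_hom_simps[OF \<kappa>_hom]

  define K where "K = \<kappa> \<circ> weyl_scalar"
  define \<rho> where "\<rho> = K \<circ> laurent_const"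
  have K_hom: "is_ring_hom K"
    unfolding K_def by (rule ring_hom_comp[OF \<kappa>_hom weyl_scalar_hom])
  have \<rho>_hom: "is_ring_hom \<rho>"
    unfolding \<rho>_def by (rule ring_hom_comp[OF K_hom laurent_const_hom])
  note hK = ring_hom_simps[OF K_hom] and h\<rho> = ring_hom_simps[OF \<rho>_hom]
  have K_central: "K r * a = a * K r" for r a
  proof (rule ore_central[OF assms(2)])
    show "K r * \<kappa> b = \<kappa> b * K r" for b
      by (simp add: K_def h\<kappa>(3)[symmetric] weyl_scalar_commute)
  qed
  have \<rho>_central: "\<rho> c * a = a * \<rho> c" for c a
    by (simp add: \<rho>_def K_central)
  have \<kappa>_inv: "invertible_elem (\<kappa> weyl_q1)" "invertible_elem (\<kappa> weyl_q2)"
    using ore_invertible[OF assms(2)] by (auto intro: mult_set.gen)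
  note \<kappa>_rel = weyl_relations_hold[THEN arg_cong[where f = \<kappa>], unfolded h\<kappa>]
  interpret W: localized_weyl "K laurent_Z" "K laurent_Zinv" "K laurent_Z'" "\<kappa> weyl_q1"
    "ring_inv (\<kappa> weyl_q1)" "\<kappa> weyl_q2" "ring_inv (\<kappa> weyl_q2)" "\<kappa> weyl_p1" "\<kappa> weyl_p2"
  proof
    show "K laurent_Z * K laurent_Zinv = 1"
      by (simp add: hK(3)[symmetric] laurent_Z_inverse hK(1))
  qed (rule K_central[symmetric] \<kappa>_rel \<kappa>_rel[symmetric] ring_inv_inverse \<kappa>_inv)+
  define h where "h = \<rho> (1/2)"
  have h: "a * h = h * a" "h + h = 1" for a
    by (simp_all add: h_def \<rho>_central h\<rho>(2)[symmetric] h\<rho>(1))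
  note IR = W.integral_relations and R = W.relations[OF h]
  obtain \<phi> where \<phi>: "is_ring_hom \<phi>" and \<phi>_gen: "\<And>c. \<phi> (jd_scalar c) = \<rho> c" "\<phi> jd_u = W.u"
    "\<phi> jd_v = h * W.V" "\<phi> jd_zeta = W.\<zeta>" "\<phi> jd_g = W.g" "\<phi> jd_ginv = W.g'"
    "\<phi> jd_x = \<kappa> weyl_q1" "\<phi> jd_y = h * W.Y"
    \<comment> \<open>Relations involving y or v are taken from \<open>R\<close>, where the factors
      1/2 are restored; the remaining ones have no such factor and come from
      \<open>IR\<close>.\<close>
    using jd_hom_exists[OF \<rho>_hom \<rho>_central, folded h_def, OF W.g_inverse IR(1,2) R(1,2) IR(5,6)
        R(3,4) IR(9) R(5,6) IR(12) R(7-9)] by blast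
  note h\<phi> = ring_hom_simps[OF \<phi>]
  have \<phi>_q: "\<phi> jd_q = \<kappa> weyl_q2"
    using W.q2_eq by (simp only: jd_q_eq h\<phi> \<phi>_gen)
  have \<phi>_inv: "invertible_elem (\<phi> s)" if "s \<in> mult_set {jd_x, jd_q}" for s
    by (rule mult_set_invertible[OF \<phi> _ that]) (auto simp: \<phi>_gen \<phi>_q \<kappa>_inv)
  obtain \<Phi> where \<Phi>: "is_ring_hom \<Phi>" and \<Phi>_\<iota>: "\<And>a. \<Phi> (\<iota> a) = \<phi> a"
    using ore_extend[OF assms(1) \<phi> \<phi>_inv] by blast
  note h\<Phi> = ring_hom_simps[OF \<Phi>]

  \<comment> \<open>The homomorphism \<Psi> from the localized Weyl algebra to the localized
    double\<close>
  define \<sigma> where "\<sigma> = \<iota> \<circ> jd_scalar"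
  have \<sigma>_hom: "is_ring_hom \<sigma>"
    unfolding \<sigma>_def by (rule ring_hom_comp[OF \<iota>_hom jd_scalar_hom])
  note h\<sigma> = ring_hom_simps[OF \<sigma>_hom]
  have \<sigma>_central: "\<sigma> c * a = a * \<sigma> c" for c a
  proof (rule ore_central[OF assms(1)])
    show "\<sigma> c * \<iota> b = \<iota> b * \<sigma> c" for b
      by (simp add: \<sigma>_def h\<iota>(3)[symmetric] jd_scalar_commute)
  qed
  have \<iota>_inv: "invertible_elem (\<iota> jd_x)" "invertible_elem (\<iota> jd_q)"
    using ore_invertible[OF assms(1)] by (auto intro: mult_set.gen)
  note \<iota>_rel = jd_relations_hold[THEN arg_cong[where f = \<iota>], unfolded h\<iota>]
  interpret D: localized_double "\<sigma> (1/2)" "\<iota> jd_u" "\<iota> jd_v" "\<iota> jd_zeta" "\<iota> jd_g" "\<iota> jd_ginv"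
    "\<iota> jd_x" "ring_inv (\<iota> jd_x)" "\<iota> jd_y" "\<iota> jd_q" "ring_inv (\<iota> jd_q)"
  proof
    show "\<iota> jd_q = \<iota> jd_u * \<iota> jd_x + (1 + \<iota> jd_g) + (1 + \<iota> jd_g)"
      by (simp only: jd_q_eq h\<iota>)
    show "\<sigma> (1/2) + \<sigma> (1/2) = 1" by (simp add: h\<sigma>(2)[symmetric] h\<sigma>(1))
  qed (simp_all add: \<iota>_rel[unfolded power2_eq_square] \<sigma>_def ring_inv_inverse[OF \<iota>_inv(1)]
        ring_inv_inverse[OF \<iota>_inv(2)])
  have z: "\<iota> jd_z = D.z"
    by (simp add: jd_z_def D.z_def h\<iota> power2_eq_square)
  have z': "jd_z' \<iota> = D.z'"
    unfolding jd_z'_def D.z'_def D.N_def h\<iota> mult_2 diff_diff_eq by (simp only: \<sigma>_def o_apply)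
  have zi: "ring_inv (\<iota> jd_z) = D.zi"
    unfolding z by (rule ring_inv_eqI[OF D.z_inverse])

  \<comment> \<open>The substitution Z to z and Z' to z' is built in two stages: \<open>P\<close>
    evaluates polynomials at z', and \<open>L\<close> adds the integer powers of z.\<close>
  define P where "P = ring_poly_eval \<sigma> D.z'"
  define L where "L = monoid_eval P (unit_power D.z D.zi)"
  have P_hom: "is_ring_hom P"
    unfolding P_def by (rule ring_poly_eval_hom[OF \<sigma>_hom \<sigma>_central])
  have L_hom: "is_ring_hom L"
    unfolding L_def
  proof (rule monoid_eval_hom[OF P_hom])
    fix p m
    have "unit_power D.z D.zi m * D.z' = D.z' * unit_power D.z D.zi m"
      by (intro unit_power_commutes D.zi_comm D.z_z')
    then show "P p * unit_power D.z D.zi m = unit_power D.z D.zi m * P p"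
      unfolding P_def by (intro ring_poly_eval_commutes[OF \<sigma>_hom \<sigma>_central] \<sigma>_central) simp
  qed (simp_all add: unit_power_simps[OF D.z_inverse] unit_power_add[OF D.z_inverse])
  note hL = ring_hom_simps[OF L_hom]
  have P_const: "P [:c:] = \<sigma> c" for c
    by (simp add: P_def ring_poly_eval_pCons[OF \<sigma>_hom \<sigma>_central]
        ring_poly_eval_zero[OF \<sigma>_hom \<sigma>_central])
  have L_gen: "L (laurent_const c) = \<sigma> c" "L laurent_Z = D.z" "L laurent_Zinv = D.zi"
    "L laurent_Z' = D.z'" for c
    by (simp_all add: L_def laurent_const_def laurent_Z_def laurent_Zinv_def laurent_Z'_def
        monoid_eval_single[OF P_hom] unit_power_simps[OF D.z_inverse] P_const ring_hom_one[OF P_hom])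
       (simp add: P_def ring_poly_eval_pCons[OF \<sigma>_hom \<sigma>_central]
        ring_poly_eval_zero[OF \<sigma>_hom \<sigma>_central] h\<sigma>)
  \<comment> \<open>It suffices to check z and z', since they generate the image of \<open>L\<close>
    together with the scalars and the inverse of z.\<close>
  have L_commute: "L r * a = a * L r" if a: "a \<in> {\<iota> jd_x, \<iota> jd_q, D.p1, D.p2}" for r a
  proof -
    have za: "D.z * a = a * D.z" "D.z' * a = a * D.z'"
      using a D.z_comm D.z_central D.z'_comm D.z'_central by auto
    show ?thesis
    proof (induction r rule: laurent_induct)
      case (mult r s)
      then show ?case unfolding hL by (metis mult.assoc)
    qed (simp_all add: L_gen \<sigma>_central za D.zi_comm hL distrib_left distrib_right)
  qed
  obtain \<psi> where \<psi>: "is_ring_hom \<psi>" and \<psi>_gen: "\<And>r. \<psi> (weyl_scalar r) = L r"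
    "\<psi> weyl_q1 = \<iota> jd_x" "\<psi> weyl_q2 = \<iota> jd_q" "\<psi> weyl_p1 = D.p1" "\<psi> weyl_p2 = D.p2"
    using weyl_hom_exists[OF L_hom L_commute D.p1_x D.p2_q D.p1_q D.p2_x D.q_comm(1)[symmetric]
        D.p1_p2] by blast
  have \<psi>_inv: "invertible_elem (\<psi> s)" if "s \<in> mult_set {weyl_q1, weyl_q2}" for s
    by (rule mult_set_invertible[OF \<psi> _ that]) (auto simp: \<psi>_gen \<iota>_inv)
  obtain \<Psi> where \<Psi>: "is_ring_hom \<Psi>" and \<Psi>_\<kappa>: "\<And>a. \<Psi> (\<kappa> a) = \<psi> a"
    using ore_extend[OF assms(2) \<psi> \<psi>_inv] by blast

  \<comment> \<open>\<Phi> composed with \<Psi> is the identity\<close>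
  have \<Phi>_\<sigma>: "\<Phi> (\<sigma> c) = \<rho> c" for c
    by (simp add: \<sigma>_def \<Phi>_\<iota> \<phi>_gen)
  have \<Phi>_z: "\<Phi> D.z = K laurent_Z"
    unfolding D.z_def by (simp add: h\<Phi> \<Phi>_\<iota> \<phi>_gen \<phi>_q W.z_eq)
  have \<Phi>_zi: "\<Phi> D.zi = K laurent_Zinv"
  proof -
    have "\<Phi> D.zi = ring_inv (\<Phi> D.z)"
      by (rule ring_inv_eqI[symmetric])
         (simp_all add: h\<Phi>(1) h\<Phi>(3)[symmetric] D.z_inverse)
    also have "\<dots> = K laurent_Zinv"
      unfolding \<Phi>_z
      by (rule ring_inv_eqI) (simp_all add: hK(1) hK(3)[symmetric] laurent_Z_inverse)
    finally show ?thesis .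
  qed
  have \<Phi>_inv: "\<Phi> (ring_inv (\<iota> jd_x)) = ring_inv (\<kappa> weyl_q1)"
    "\<Phi> (ring_inv (\<iota> jd_q)) = ring_inv (\<kappa> weyl_q2)"
    by (simp_all add: ring_hom_ring_inv[OF \<Phi>] \<iota>_inv \<Phi>_\<iota> \<phi>_gen \<phi>_q)
  have \<Phi>_z': "\<Phi> D.z' = K laurent_Z'"
  proof -
    \<comment> \<open>The numerator goes to q2 times Z'; the inverse of q in front of it cancels the
      factor q2.\<close>
    have "\<Phi> D.N = \<kappa> weyl_q2 * K laurent_Z'"
      using W.N_eq[OF h] by (simp add: D.N_def h\<Phi> \<Phi>_\<iota> \<Phi>_\<sigma> \<phi>_gen h_def[symmetric])
    then show ?thesis
      by (simp add: D.z'_def h\<Phi> \<Phi>_inv mult.assoc[symmetric] W.q2)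
  qed
  have \<Phi>_L: "\<Phi> (L r) = K r" for r
    by (induction r rule: laurent_induct)
       (simp_all add: L_gen \<Phi>_\<sigma> \<rho>_def \<Phi>_z \<Phi>_zi \<Phi>_z' hL h\<Phi> hK)
  have \<Phi>_p: "\<Phi> D.p1 = \<kappa> weyl_p1" "\<Phi> D.p2 = \<kappa> weyl_p2"
  proof -
    show "\<Phi> D.p1 = \<kappa> weyl_p1"
      by (simp add: D.p1_def h\<Phi> \<Phi>_\<iota> \<Phi>_inv \<phi>_gen W.p1_eq)
    have "\<Phi> D.Y = W.Y"
      by (simp add: D.Y_def h\<Phi> \<Phi>_\<iota> \<phi>_gen W.half_twice[OF h])
    then have "\<Phi> D.p2
        = - (ring_inv (\<kappa> weyl_q1) * (ring_inv (\<kappa> weyl_q2) * (W.Y + \<kappa> weyl_q1 * W.\<zeta>)))"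
      by (simp only: D.p2_def h\<Phi> \<Phi>_\<iota> \<Phi>_inv \<phi>_gen)
    then show "\<Phi> D.p2 = \<kappa> weyl_p2" by (simp only: W.p2_eq)
  qed
  have \<Phi>_\<psi>: "\<Phi> (\<psi> a) = \<kappa> a" for a
    by (induction a rule: weyl_induct)
       (simp_all add: \<psi>_gen \<Phi>_L K_def \<Phi>_\<iota> \<phi>_gen \<phi>_q \<Phi>_p ring_hom_simps[OF \<psi>] h\<Phi> h\<kappa>)
  have "\<Phi> \<circ> \<Psi> = id"
  proof (rule ore_hom_unique[OF assms(2)])
    show "is_ring_hom (\<Phi> \<circ> \<Psi>)" by (rule ring_hom_comp[OF \<Phi> \<Psi>])
  qed (simp_all add: is_ring_hom_def \<Psi>_\<kappa> \<Phi>_\<psi>)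
  then have \<Phi>_\<Psi>: "\<Phi> (\<Psi> b) = b" for b by (metis comp_apply id_apply)

  \<comment> \<open>Surjectivity of \<Psi> and bijectivity of \<Phi>\<close>
  note T = ring_hom_range[OF \<Psi>]
  have T_base: "L r \<in> range \<Psi>" "\<iota> jd_x \<in> range \<Psi>" "\<iota> jd_q \<in> range \<Psi>" "D.p1 \<in> range \<Psi>"
    "D.p2 \<in> range \<Psi>" "ring_inv (\<iota> jd_x) \<in> range \<Psi>" "ring_inv (\<iota> jd_q) \<in> range \<Psi>" for r
    using \<Psi>_\<kappa>[of "weyl_scalar r"] \<Psi>_\<kappa>[of weyl_q1] \<Psi>_\<kappa>[of weyl_q2] \<Psi>_\<kappa>[of weyl_p1] \<Psi>_\<kappa>[of weyl_p2]
      ring_hom_ring_inv[OF \<Psi> \<kappa>_inv(1)] ring_hom_ring_inv[OF \<Psi> \<kappa>_inv(2)]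
    by (simp_all add: \<psi>_gen) (metis rangeI)+
  have T_L: "\<sigma> c \<in> range \<Psi>" "D.z \<in> range \<Psi>" "D.zi \<in> range \<Psi>" "D.z' \<in> range \<Psi>" for c
    using T_base(1) L_gen by metis+
  \<comment> \<open>The generators are reached in the order \<zeta>, g, u, y, v, each from the
    elements already known to lie in the range.\<close>
  have T_\<zeta>: "\<iota> jd_zeta \<in> range \<Psi>"
    by (subst D.\<zeta>_eq) (intro T T_base)
  have T_g: "\<iota> jd_g \<in> range \<Psi>" "\<iota> jd_ginv \<in> range \<Psi>"
    by (subst D.g_eq, intro T T_base T_L)+
  have T_u: "\<iota> jd_u \<in> range \<Psi>"
    by (subst D.u_eq) (intro T T_base T_g)
  have T_y: "\<iota> jd_y \<in> range \<Psi>"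
    by (subst D.y_eq) (intro T T_base T_\<zeta> T_L)
  have T_v: "\<iota> jd_v \<in> range \<Psi>"
    by (subst D.v_eq) (intro T T_base T_L T_u T_y T_g T_\<zeta>)
  have T_\<iota>: "\<iota> a \<in> range \<Psi>" for a
    by (induction a rule: jd_induct)
       (use T_L(1) in \<open>simp_all add: T_u T_v T_\<zeta> T_g T_base T_y h\<iota> T \<sigma>_def\<close>)
  have T_inv: "ring_inv (\<iota> s) \<in> range \<Psi>" if "s \<in> mult_set {jd_x, jd_q}" for s
  proof -
    \<comment> \<open>The inverse of a product is the product of the inverses in reverse order, so
      only the inverses of x and q have to lie in the range.\<close>
    have "\<exists>b\<in>range \<Psi>. \<iota> s * b = 1 \<and> b * \<iota> s = 1"
      using that
    proof (induction rule: mult_set.induct)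
      case one
      show ?case using T(5) by (auto simp: h\<iota>)
    next
      case (gen a)
      then show ?case using T_base(6,7) D.xx' D.qq' by blast
    next
      case (mult s t)
      then obtain b c where "b \<in> range \<Psi>" "\<iota> s * b = 1" "b * \<iota> s = 1"
        "c \<in> range \<Psi>" "\<iota> t * c = 1" "c * \<iota> t = 1" by blast
      then have "c * b \<in> range \<Psi>" "\<iota> (s * t) * (c * b) = 1" "c * b * \<iota> (s * t) = 1"
        unfolding h\<iota> by (metis T(2), (metis mult.assoc mult_1_left)+)
      then show ?case by blast
    qed
    then show ?thesis using ring_inv_eqI by metis
  qed
  have \<Psi>_surj: "b \<in> range \<Psi>" for b
  proof -
    obtain a s where "s \<in> mult_set {jd_x, jd_q}" "b * \<iota> s = \<iota> a"
      by (rule ore_right_fraction[OF assms(1)])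
    then have "b = \<iota> a * ring_inv (\<iota> s)"
      by (metis mult.assoc mult_1_right ore_invertible[OF assms(1)] ring_inv_inverse(1))
    then show ?thesis using T(2)[OF T_\<iota> T_inv] \<open>s \<in> _\<close> by simp
  qed
  \<comment> \<open>A surjective map with a left inverse is inverse to it on both sides.\<close>
  then have \<Psi>_\<Phi>: "\<Psi> (\<Phi> b) = b" for b
    using \<Phi>_\<Psi> by (metis imageE)
  have bij: "bij \<Phi>"
    using \<Phi>_\<Psi> \<Psi>_\<Phi> by (metis bijI')

  \<comment> \<open>Algebraic independence of z and z'\<close>
  have K_inj: "r = 0" if "K r = 0" for r
  proof -
    have "\<kappa> (weyl_scalar r) = 0" using that by (simp add: K_def)
    then obtain s where "s \<in> mult_set {weyl_q1, weyl_q2}" "weyl_scalar r * s = 0"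
      using ore_kernel[OF assms(2)] by blast
    then show ?thesis by (rule weyl_scalar_torsion_free)
  qed
  have independent: "algebraically_independent2 \<sigma> D.z D.z'"
    unfolding algebraically_independent2_def
  proof (intro conjI allI impI)
    show "D.z * D.z' = D.z' * D.z" by (rule D.z_z')
    fix Q assume "eval_poly2 \<sigma> D.z D.z' Q = 0"
    \<comment> \<open>A polynomial relation between z and z' is the image under \<open>L\<close> of
      the same expression in Z and Z'. Applying \<Phi> turns \<open>L\<close> into \<open>K\<close>,
      which has trivial kernel.\<close>
    then have "L (\<Sum>i\<le>degree Q. \<Sum>j\<le>degree (coeff Q i).
      laurent_const (coeff (coeff Q i) j) * laurent_Z ^ i * laurent_Z' ^ j) = 0"
      by (simp add: eval_poly2_def hL L_gen)
    then have "K (\<Sum>i\<le>degree Q. Poly_Mapping.single (int i) (coeff Q i)) = 0"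
      unfolding eval_poly2_laurent by (metis \<Phi>_L h\<Phi>(4))
    then show "Q = 0" using K_inj eval_poly2_laurent_zero by blast
  qed

  \<comment> \<open>The center\<close>
  have L_center: "L r * a = a * L r" for r a
    by (metis \<Phi>_L K_central h\<Phi>(3) \<Psi>_\<Phi>)
  have "ring_center = generated_subalgebra \<sigma> {D.z, D.zi, D.z'}"
  proof
    show "generated_subalgebra \<sigma> {D.z, D.zi, D.z'} \<subseteq> ring_center"
    proof
      fix c assume "c \<in> generated_subalgebra \<sigma> {D.z, D.zi, D.z'}"
      then have "\<exists>r. c = L r"
      proof (induction rule: generated_subalgebra.induct)
        case (scalar c)
        show ?case by (metis L_gen(1))
      next
        case (gen a)
        then show ?case by (metis L_gen(2-4) empty_iff insert_iff)
      next
        case (add a b)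
        then show ?case by (metis hL(2))
      next
        case (mult a b)
        then show ?case by (metis hL(3))
      qed
      then show "c \<in> ring_center" using L_center by (auto simp: ring_center_def)
    qed
    show "ring_center \<subseteq> generated_subalgebra \<sigma> {D.z, D.zi, D.z'}"
    proof
      fix c :: 'd assume c: "c \<in> ring_center"
      interpret weyl_image \<kappa> by standard (rule \<kappa>_hom)
      have torsion_free: "n = 0 \<or> a = 0" if "of_int n * a = (0 :: 'w)" for n a
      proof (rule disjCI)
        assume "a \<noteq> 0"
        \<comment> \<open>In characteristic 0 a nonzero integer is an invertible scalar, so it
          annihilates only 0.\<close>
        have "\<rho> (of_int n) * a = 0" using that by (simp add: ring_hom_of_int[OF \<rho>_hom])
        then have "\<rho> (inverse (of_int n) * of_int n) * a = 0"
          by (simp only: h\<rho> mult.assoc mult_zero_right)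
        then show "n = 0" using \<open>a \<noteq> 0\<close> by (cases "n = 0") (simp_all add: h\<rho>)
      qed
      \<comment> \<open>A left denominator of \<open>\<Phi> c\<close> is a monomial in q1 and q2,
        which is the form required by \<open>center_in_scalars\<close>.\<close>
      obtain b s where "s \<in> mult_set {weyl_q1, weyl_q2}" "\<kappa> s * \<Phi> c = \<kappa> b"
        by (rule ore_left_fraction[OF assms(2)])
      moreover from this obtain i j where "s = weyl_q1 ^ i * weyl_q2 ^ j"
        using weyl_q_monomial by blast
      ultimately have "\<kappa> weyl_q1 ^ i * (\<kappa> weyl_q2 ^ j * \<Phi> c) = \<kappa> b"
        by (simp add: h\<kappa> mult.assoc)
      moreover have "\<Phi> c * \<kappa> a = \<kappa> a * \<Phi> c" for a
      proof -
        have "\<Phi> (c * \<Psi> (\<kappa> a)) = \<Phi> (\<Psi> (\<kappa> a) * c)"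
          using c by (simp add: ring_center_def)
        then show ?thesis by (simp add: h\<Phi> \<Phi>_\<Psi>)
      qed
      ultimately have "\<Phi> c \<in> range (\<lambda>r. \<kappa> (weyl_scalar r))"
        using center_in_scalars[OF _ \<kappa>_inv] torsion_free by blast
      then obtain r where "\<Phi> c = K r" by (auto simp: K_def)
      \<comment> \<open>The central element \<open>\<Phi> c\<close> is the scalar
        \<open>K r\<close>, and \<Psi> carries it back to \<open>L r\<close>, an expression in z,
        its inverse and z'.\<close>
      then have "c = L r" by (metis \<Phi>_L \<Psi>_\<Phi>)
      moreover have "L r \<in> generated_subalgebra \<sigma> {D.z, D.zi, D.z'}"
        by (induction r rule: laurent_induct)
           (simp_all add: L_gen hL generated_subalgebra.intros)
      ultimately show "c \<in> generated_subalgebra \<sigma> {D.z, D.zi, D.z'}" by simp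
    qed
  qed
  then show ?thesis
    using independent \<Phi> bij \<Phi>_\<sigma> \<Phi>_z \<Phi>_z'
    unfolding z z' zi[unfolded z] \<sigma>_def[symmetric]
    by (auto simp: \<sigma>_def \<rho>_def K_def)
qed

end
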